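(* For every integer $n\ge 0$ there is a weight-preserving bijection between oscillating tableaux of length $2n$, weighted by the first-column statistic (each number that appears in the first column only has weight $c$, and all other numbers have weight $1$), and complete matchings of $[2n]$ in which edges that are not nested by any other edge have weight $c$ and all other edges have weight $1$.
   Context: Weights of objects are products of the weights of their parts; $c$ is an indeterminate. A complete matching of $[2n]=\{1,\dots,2n\}$ is a partition of $[2n]$ into blocks of size $2$ (edges), written $(a,b)$ with $a<b$; $(a,b)$ is nested by $(a',b')$ if $a'<a<b<b'$. An oscillating tableau of length $2n$ is a sequence of integer partitions (Ferrers shapes) $\emptyset=\lambda^0,\lambda^1,\dots,\lambda^{2n}=\emptyset$ in which each $\lambda^{i}$ is obtained from $\lambda^{i-1}$ by adding or removing exactly one box. The numbers of an oscillating tableau are defined by filling its shapes from right to left, producing a filling $T_i$ of each $\lambda^i$ with distinct positive integers increasing along rows and down columns. Start with $T_{2n}=\emptyset$. If $\lambda^{i-1}$ is larger than $\lambda^i$, then $T_{i-1}$ is obtained from $T_i$ by putting in the new box the smallest positive integer not yet used (so the integers $1,2,\dots,n$ are introduced in this order). If $\lambda^{i-1}$ is smaller than $\lambda^{i}$, then $T_{i-1}$ is the unique tableau of shape $\lambda^{i-1}$ such that RSK row-inserting some number into $T_{i-1}$ gives $T_i$ (i.e. $T_{i-1}$ is obtained by reverse row insertion, "unbumping", starting from the box $\lambda^i/\lambda^{i-1}$). A number $j\in\{1,\dots,n\}$ appears in the first column only if, in every $T_i$ containing $j$, the entry $j$ is in the first column. Thus the weight of an oscillating tableau is $c$ raised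 to the number of $j\in\{1,\dots,n\}$ appearing in the first column only. *)

theory Defs
  imports "HOL-Library.Disjoint_Sets" "HOL-Computational_Algebra.Polynomial"
begin

text \<open>Weights live in \<open>\<int>[c]\<close>; the indeterminate \<open>c\<close> is \<open>wt_c\<close>.\<close>

definition wt_c :: "int poly" where
  "wt_c = [:0, 1:]"

definition complete_matchings :: "nat set \<Rightarrow> nat set set set" where
  "complete_matchings V = {M. partition_on V M \<and> (\<forall>e\<in>M. card e = 2)}"

text \<open>A block \<open>{a, b}\<close> with \<open>a < b\<close> is the edge \<open>(a, b) = (Min e, Max e)\<close>.\<close>

definition nested_by :: "nat set \<Rightarrow> nat set \<Rightarrow> bool" where
  "nested_by e e' \<longleftrightarrow> Min e' < Min e \<and> Min e < Max e \<and> Max e < Max e'"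

definition matching_weight :: "nat set set \<Rightarrow> int poly" where
  "matching_weight M = (\<Prod>e\<in>M. if \<exists>e'\<in>M. nested_by e e' then 1 else wt_c)"

definition is_partition :: "nat list \<Rightarrow> bool" where
  "is_partition la \<longleftrightarrow> sorted_wrt (\<ge>) la \<and> 0 \<notin> set la"

text \<open>Boxes are (row, column) pairs, both counted from 0.\<close>

definition boxes :: "nat list \<Rightarrow> (nat \<times> nat) set" where
  "boxes la = {(i, j). i < length la \<and> j < la ! i}"

definition adds_box :: "nat list \<Rightarrow> nat list \<Rightarrow> bool" where
  "adds_box mu la \<longleftrightarrow> (\<exists>b. b \<notin> boxes mu \<and> boxes la = insert b (boxes mu))"

text \<open>Length \<open>m\<close> counts steps, so the sequence has \<open>m + 1\<close> shapes.\<close>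

definition oscillating_tableaux :: "nat \<Rightarrow> nat list list set" where
  "oscillating_tableaux m = {L. length L = m + 1 \<and> (\<forall>la\<in>set L. is_partition la) \<and>
     L ! 0 = [] \<and> L ! m = [] \<and>
     (\<forall>i\<in>{1..m}. adds_box (L ! (i - 1)) (L ! i) \<or> adds_box (L ! i) (L ! (i - 1)))}"

text \<open>A filling is the list of its rows, from top to bottom.\<close>

type_synonym tableau = "nat list list"

definition shape :: "tableau \<Rightarrow> nat list" where
  "shape T = map length T"

definition entries :: "tableau \<Rightarrow> nat set" where
  "entries T = set (concat T)"

definition is_tableau :: "tableau \<Rightarrow> bool" where
  "is_tableau T \<longleftrightarrow> is_partition (shape T) \<and> distinct (concat T) \<and> 0 \<notin> entries T \<and>
     (\<forall>r\<in>set T. sorted_wrt (<) r) \<and>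
     (\<forall>i j. (Suc i, j) \<in> boxes (shape T) \<longrightarrow> T ! i ! j < T ! Suc i ! j)"

text \<open>The second component is the entry bumped out of the row, if any.\<close>

fun bump :: "nat \<Rightarrow> nat list \<Rightarrow> nat list \<times> nat option" where
  "bump x [] = ([x], None)"
| "bump x (y # ys) =
     (if x < y then (x # ys, Some y) else (let (zs, b) = bump x ys in (y # zs, b)))"

fun row_insert :: "nat \<Rightarrow> tableau \<Rightarrow> tableau" where
  "row_insert x [] = [[x]]"
| "row_insert x (r # rs) =
     (case bump x r of (r', None) \<Rightarrow> r' # rs | (r', Some y) \<Rightarrow> r' # row_insert y rs)"

definition reverse_insert :: "nat list \<Rightarrow> tableau \<Rightarrow> tableau" where
  "reverse_insert la T = (THE S. is_tableau S \<and> shape S = la \<and> (\<exists>x. row_insert x S = T))"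

text \<open>\<open>T\<close> is kept on its own shape and the remaining box of \<open>la\<close> receives \<open>k\<close>.\<close>

definition put_in_new_box :: "nat list \<Rightarrow> nat \<Rightarrow> tableau \<Rightarrow> tableau" where
  "put_in_new_box la k T =
     map (\<lambda>i. map (\<lambda>j. if (i, j) \<in> boxes (shape T) then T ! i ! j else k) [0..<la ! i])
       [0..<length la]"

definition smallest_unused :: "tableau list \<Rightarrow> nat" where
  "smallest_unused Ts = (LEAST k. 0 < k \<and> (\<forall>T\<in>set Ts. k \<notin> entries T))"

text \<open>
  The shapes are filled from right to left: in the last equation \<open>Ts\<close> consists of the fillings
  of all later shapes, starting with that of \<open>mu\<close>.
\<close>

fun fillings :: "nat list list \<Rightarrow> tableau list" where
  "fillings [] = []"
| "fillings [la] = [[]]"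
| "fillings (la # mu # L) =
     (let Ts = fillings (mu # L) in
      (if adds_box mu la then put_in_new_box la (smallest_unused Ts) (hd Ts)
       else reverse_insert la (hd Ts)) # Ts)"

definition first_column_only :: "tableau list \<Rightarrow> nat \<Rightarrow> bool" where
  "first_column_only Ts k \<longleftrightarrow>
     (\<forall>T\<in>set Ts. \<forall>(i, j)\<in>boxes (shape T). T ! i ! j = k \<longrightarrow> j = 0)"

text \<open>A tableau of length \<open>2 * n\<close> uses exactly the numbers \<open>1, \<dots>, n\<close>.\<close>

definition tableau_weight :: "nat \<Rightarrow> nat list list \<Rightarrow> int poly" where
  "tableau_weight n L = (\<Prod>k\<in>{1..n}. if first_column_only (fillings L) k then wt_c else 1)"

end

(*
  Read an oscillating tableau from right to left: each step either introduces the next number or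
  ejects a present one by reverse insertion. Since row insertion is invertible given the shapes, the
  final filling together with the list of these events determines the tableau, and every list of
  events that ejects only present numbers arises. Joining the step that introduces a number to the
  step that ejects it gives the matching.

  Read from left to right, a number is inserted into the first row and then only moves down and to
  the left, so it stays in the first column exactly if it enters there, i.e. if it is smaller than
  all numbers then present. Numbers then present belong to edges that are open at that time, and
  the smaller ones among them end further to the right, i.e. they nest the new edge.
*)
theory Submission
  imports Defs
begin

subsection \<open>Shapes\<close>

text \<open>\<open>fillings\<close> is awkward to reason about directly: it runs from the right and
  takes its entries from a definite description (\<open>reverse_insert\<close>) and from a minimum
  over all later fillings (\<open>smallest_unused\<close>). The construction therefore goes the
  opposite way. A list of events and a leftmost filling generate the later fillings by two total
  functions, deletion of the largest number and row insertion; that \<open>fillings\<close> recovers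
  this sequence from its shapes is a separate fact. Since lists of events grow at the head, the
  inductions have to cover sequences whose first shape is not empty and matchings with unmatched
  positions. On the matching side an unmatched position is the promise of an edge that ends beyond
  everything read so far, which makes the nesting status of an edge final as soon as the edge is
  closed. On the tableau side the status of a number is final as soon as it is ejected. Both weights
  thus collect one factor per ejection, and the factors agree because numbers are introduced in
  increasing order, so that comparing numbers amounts to comparing positions.\<close>

fun grow :: "nat list \<Rightarrow> nat list \<Rightarrow> bool" where
  "grow [] la = (la = [1])"
| "grow (m # mu) [] = False"
| "grow (m # mu) (l # la) = (l = Suc m \<and> la = mu \<or> l = m \<and> grow mu la)"

lemma is_partition_Nil: "is_partition []"
  by (simp add: is_partition_def)

lemma mem_boxes_Nil: "b \<notin> boxes []"
  by (simp add: boxes_def)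

lemma mem_boxes_Cons_0: "(0, j) \<in> boxes (l # la) \<longleftrightarrow> j < l"
  by (simp add: boxes_def)

lemma mem_boxes_Cons_Suc: "(Suc i, j) \<in> boxes (l # la) \<longleftrightarrow> (i, j) \<in> boxes la"
  by (simp add: boxes_def)

lemmas mem_boxes = mem_boxes_Nil mem_boxes_Cons_0 mem_boxes_Cons_Suc

text \<open>A part 0 contributes no box: \<open>[]\<close> and \<open>[0]\<close> have the same
  boxes, hence the two assumptions on zeros.\<close>

lemma boxes_inject:
  assumes "0 \<notin> set la" "0 \<notin> set mu" "boxes la = boxes mu"
  shows "la = mu"
  using assms
proof (induction la arbitrary: mu)
  case Nil
  show ?case
  proof (cases mu)
    case (Cons m mu')
    then have "(0, 0) \<in> boxes mu" using Nil by (simp add: mem_boxes)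
    then have "(0, 0) \<in> boxes []" using Nil by metis
    then show ?thesis by (simp add: mem_boxes)
  qed simp
next
  case (Cons l la)
  have "(0, 0) \<in> boxes mu" using Cons.prems by (metis list.set_intros(1) mem_boxes_Cons_0 neq0_conv)
  then obtain m mu' where mu: "mu = m # mu'" by (cases mu) (auto simp: mem_boxes)
  have "j < l \<longleftrightarrow> j < m" for j
    using Cons.prems(3) mu by (metis mem_boxes_Cons_0)
  then have "l = m" by (metis linorder_neqE_nat less_irrefl)
  moreover have "(i, j) \<in> boxes la \<longleftrightarrow> (i, j) \<in> boxes mu'" for i j
    using Cons.prems(3) mu by (metis mem_boxes_Cons_Suc)
  then have "boxes la = boxes mu'" by auto
  ultimately show ?case using Cons mu by auto
qed

text \<open>\<open>adds_box\<close> speaks of sets, whereas tableaux are processed row by row. The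
  additional box lies either in the first row, and then \<open>boxes_inject\<close> identifies the
  tails, or in the tail, and then the first rows agree.\<close>

lemma adds_box_grow:
  assumes "0 \<notin> set mu" "0 \<notin> set la"
  shows "adds_box mu la \<longleftrightarrow> grow mu la"
proof
  assume "adds_box mu la"
  then show "grow mu la"
    using assms
  proof (induction mu arbitrary: la)
    case Nil
    then obtain b where "boxes la = insert b (boxes [])" by (auto simp: adds_box_def)
    moreover have "boxes [] = {}" by (simp add: boxes_def)
    ultimately have b: "boxes la = {b}" by simp
    then obtain l la' where la: "la = l # la'" by (cases la) (auto simp: mem_boxes boxes_def)
    have "(0, 0) \<in> boxes la" using Nil la by (simp add: mem_boxes)
    with b have b0: "boxes la = {(0, 0)}" by auto
    have "la = [1]"
    proof (rule boxes_inject)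
      have "boxes [1] = {(0, 0)}" by (auto simp: boxes_def)
      then show "boxes la = boxes [1]" using b0 by simp
    qed (use Nil in auto)
    then show ?case by simp
  next
    case (Cons m mu)
    then obtain b where b: "b \<notin> boxes (m # mu)" "boxes la = insert b (boxes (m # mu))"
      by (auto simp: adds_box_def)
    then obtain l la' where la: "la = l # la'" by (cases la) (auto simp: mem_boxes)
    obtain i j where ij: "b = (i, j)" by (cases b)
    show ?case
    proof (cases i)
      case 0
      have "(p, q) \<in> boxes la' \<longleftrightarrow> (p, q) \<in> boxes mu" for p q
      proof -
        have "(Suc p, q) \<in> boxes la \<longleftrightarrow> (Suc p, q) \<in> boxes (m # mu)"
          using b ij 0 by auto
        then show ?thesis using la by (simp add: mem_boxes)
      qed
      then have "boxes la' = boxes mu" by auto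
      then have eq: "la' = mu" using Cons.prems la by (intro boxes_inject) auto
      have q: "q < l \<longleftrightarrow> q < m \<or> q = j" for q
      proof -
        have "(0, q) \<in> boxes la \<longleftrightarrow> (0, q) \<in> boxes (m # mu) \<or> q = j"
          using b ij 0 by auto
        then show ?thesis using la by (simp add: mem_boxes)
      qed
      have "\<not> j < m" using b ij 0 by (auto simp: mem_boxes)
      then have "l = Suc m" using q[of m] q[of j] q[of "Suc m"] q[of "l - 1"] by auto
      then show ?thesis using eq la by simp
    next
      case (Suc i')
      have q: "q < l \<longleftrightarrow> q < m" for q
      proof -
        have "(0, q) \<in> boxes la \<longleftrightarrow> (0, q) \<in> boxes (m # mu)"
          using b ij Suc by auto
        then show ?thesis using la by (simp add: mem_boxes)
      qed
      then have "l = m" by (metis linorder_neqE_nat less_irrefl)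
      moreover have "boxes la' = insert (i', j) (boxes mu)"
      proof -
        have "(p, q) \<in> boxes la' \<longleftrightarrow> (p, q) \<in> insert (i', j) (boxes mu)" for p q
        proof -
          have "(Suc p, q) \<in> boxes la \<longleftrightarrow> (Suc p, q) \<in> insert (Suc i', j) (boxes (m # mu))"
            using b ij Suc by auto
          then show ?thesis using la by (simp add: mem_boxes)
        qed
        then show ?thesis by auto
      qed
      moreover have "(i', j) \<notin> boxes mu" using b ij Suc by (auto simp: mem_boxes)
      ultimately show ?thesis using Cons la by (auto simp: adds_box_def)
    qed
  qed
next
  assume "grow mu la"
  then show "adds_box mu la"
  proof (induction mu la rule: grow.induct)
    case (1 la)
    then have "boxes la = insert (0, 0) (boxes [])" by (auto simp: boxes_def)
    then show ?case unfolding adds_box_def using mem_boxes_Nil by blast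
  next
    case (2 m mu)
    then show ?case by simp
  next
    case (3 m mu l la)
    show ?case
    proof (cases "l = Suc m \<and> la = mu")
      case True
      have "boxes (l # la) = insert (0, m) (boxes (m # mu))"
      proof -
        have "(p, q) \<in> boxes (l # la) \<longleftrightarrow> (p, q) \<in> insert (0, m) (boxes (m # mu))" for p q
          using True by (cases p) (auto simp: mem_boxes)
        then show ?thesis by auto
      qed
      moreover have "(0, m) \<notin> boxes (m # mu)" by (simp add: mem_boxes)
      ultimately show ?thesis unfolding adds_box_def by blast
    next
      case False
      then have *: "l = m" "grow mu la" using 3 by auto
      then obtain i j where b: "(i, j) \<notin> boxes mu" "boxes la = insert (i, j) (boxes mu)"
        using "3.IH" by (auto simp: adds_box_def)
      have "boxes (l # la) = insert (Suc i, j) (boxes (m # mu))"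
      proof -
        have "(p, q) \<in> boxes (l # la) \<longleftrightarrow> (p, q) \<in> insert (Suc i, j) (boxes (m # mu))" for p q
          using * b by (cases p) (auto simp: mem_boxes)
        then show ?thesis by auto
      qed
      moreover have "(Suc i, j) \<notin> boxes (m # mu)" using b by (simp add: mem_boxes)
      ultimately show ?thesis unfolding adds_box_def by blast
    qed
  qed
qed

lemma grow_sum_list: "grow mu la \<Longrightarrow> sum_list la = Suc (sum_list mu)"
  by (induction mu la rule: grow.induct) auto

lemma grow_asym: "grow mu la \<Longrightarrow> \<not> grow la mu"
  using grow_sum_list[of mu la] grow_sum_list[of la mu] by auto

subsection \<open>Tableaux row by row\<close>

text \<open>The length comparison, together with nonempty rows, encodes in \<open>tab\<close> that
  the shape is a partition.\<close>

definition above :: "nat list \<Rightarrow> nat list \<Rightarrow> bool" where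
  "above r s \<longleftrightarrow> length s \<le> length r \<and> (\<forall>j<length s. r ! j < s ! j)"

definition top_row :: "tableau \<Rightarrow> nat list" where
  "top_row T = (case T of [] \<Rightarrow> [] | r # _ \<Rightarrow> r)"

fun tab :: "tableau \<Rightarrow> bool" where
  "tab [] = True"
| "tab (r # rs) = (r \<noteq> [] \<and> sorted_wrt (<) r \<and> above r (top_row rs) \<and> tab rs)"

lemma top_row_simps [simp]: "top_row [] = []" "top_row (r # rs) = r"
  by (simp_all add: top_row_def)

lemma above_Nil [simp]: "above r []"
  by (simp add: above_def)

lemma entries_simps [simp]: "entries [] = {}" "entries (r # rs) = set r \<union> entries rs"
  by (simp_all add: entries_def)

lemma shape_simps [simp]: "shape [] = []" "shape (r # rs) = length r # shape rs"
  by (simp_all add: shape_def)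

lemma is_partition_Cons_iff:
  "is_partition (l # la) \<longleftrightarrow> 0 < l \<and> (la \<noteq> [] \<longrightarrow> hd la \<le> l) \<and> is_partition la"
  by (cases la) (auto simp: is_partition_def)

lemma length_top_row: "length (top_row T) = (if T = [] then 0 else hd (shape T))"
  by (cases T) auto

lemma tab_iff:
  "tab T \<longleftrightarrow> is_partition (shape T) \<and> (\<forall>r\<in>set T. sorted_wrt (<) r) \<and>
     (\<forall>i j. (Suc i, j) \<in> boxes (shape T) \<longrightarrow> T ! i ! j < T ! Suc i ! j)"
proof (induction T)
  case Nil
  then show ?case by (simp add: is_partition_Nil mem_boxes)
next
  case (Cons r rs)
  have col: "(\<forall>i j. (Suc i, j) \<in> boxes (shape (r # rs)) \<longrightarrow> (r # rs) ! i ! j < (r # rs) ! Suc i ! j)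
    \<longleftrightarrow> (\<forall>j<length (top_row rs). r ! j < top_row rs ! j) \<and>
        (\<forall>i j. (Suc i, j) \<in> boxes (shape rs) \<longrightarrow> rs ! i ! j < rs ! Suc i ! j)"
    (is "?L \<longleftrightarrow> ?R")
  proof -
    have "?L \<longleftrightarrow> (\<forall>j. (0, j) \<in> boxes (shape rs) \<longrightarrow> r ! j < rs ! 0 ! j) \<and>
        (\<forall>i j. (Suc i, j) \<in> boxes (shape rs) \<longrightarrow> rs ! i ! j < rs ! Suc i ! j)"
      by (auto simp: mem_boxes nth_Cons split: nat.splits)
    also have "\<dots> \<longleftrightarrow> ?R"
      by (cases rs) (auto simp: mem_boxes)
    finally show ?thesis .
  qed
  show ?case
    unfolding col using Cons.IH
    by (cases rs) (auto simp: is_partition_Cons_iff above_def)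
qed

lemma is_tableau_iff: "is_tableau T \<longleftrightarrow> tab T \<and> distinct (concat T) \<and> 0 \<notin> entries T"
  unfolding is_tableau_def tab_iff by blast

subsection \<open>Row insertion\<close>

text \<open>Turns the recursion of \<open>bump\<close> into an append or a single update at the
  first entry exceeding \<open>x\<close>. The entries passed over are only known to be
  \<open>\<le> x\<close>; strictness comes later, from \<open>x\<close> not being an entry.\<close>

lemma bump_cases:
  obtains (append) "bump x r = (r @ [x], None)" "\<forall>y\<in>set r. y \<le> x"
  | (replace) i where "i < length r" "bump x r = (r[i := x], Some (r ! i))" "x < r ! i"
      "\<forall>j<i. r ! j \<le> x"
proof -
  have "bump x r = (r @ [x], None) \<and> (\<forall>y\<in>set r. y \<le> x) \<or>
    (\<exists>i<length r. bump x r = (r[i := x], Some (r ! i)) \<and> x < r ! i \<and> (\<forall>j<i. r ! j \<le> x))"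
  proof (induction r)
    case Nil
    then show ?case by simp
  next
    case (Cons y ys)
    show ?case
    proof (cases "x < y")
      case True
      then show ?thesis by (intro disjI2 exI[of _ 0]) simp
    next
      case False
      from Cons.IH show ?thesis
      proof (elim disjE exE conjE)
        fix i
        assume "i < length ys" "bump x ys = (ys[i := x], Some (ys ! i))" "x < ys ! i"
          "\<forall>j<i. ys ! j \<le> x"
        then show ?thesis using False
          by (intro disjI2 exI[of _ "Suc i"]) (auto simp: less_Suc_eq_0_disj)
      qed (use False in auto)
    qed
  qed
  then show thesis using append replace by blast
qed

lemma bump_append: "\<forall>y\<in>set r. y \<le> x \<Longrightarrow> bump x r = (r @ [x], None)"
  by (rule bump_cases[of x r]) (auto simp: not_le[symmetric])

lemma bump_replace:
  assumes "i < length r" "x < r ! i" "\<forall>j<i. r ! j \<le> x"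
  shows "bump x r = (r[i := x], Some (r ! i))"
proof (cases rule: bump_cases[of x r])
  case append
  then show ?thesis using assms by (meson leD nth_mem)
next
  case (replace k)
  then have "k = i" using assms by (metis leD linorder_neqE_nat)
  then show ?thesis using replace by simp
qed

lemma bump_mset:
  "mset (fst (bump x r)) + (case snd (bump x r) of None \<Rightarrow> {#} | Some y \<Rightarrow> {#y#}) = add_mset x (mset r)"
  by (cases rule: bump_cases[of x r]) (auto simp: mset_update)

text \<open>Insertion merely moves entries between rows. Counting multiplicities yields the entry
  set and the distinctness of the result together.\<close>

lemma mset_row_insert: "mset (concat (row_insert x T)) = add_mset x (mset (concat T))"
proof (induction T arbitrary: x)
  case Nil
  then show ?case by simp
next
  case (Cons r rs)
  then show ?case using bump_mset[of x r]
    by (auto split: prod.splits option.splits)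
qed

lemma entries_row_insert: "entries (row_insert x T) = insert x (entries T)"
  unfolding entries_def by (metis mset_row_insert set_mset_mset set_mset_add_mset_insert)

lemma distinct_row_insert:
  "distinct (concat (row_insert x T)) \<longleftrightarrow> distinct (concat T) \<and> x \<notin> entries T"
proof -
  have "distinct (concat (row_insert x T)) \<longleftrightarrow> distinct (x # concat T)"
    by (metis mset_row_insert mset_eq_imp_distinct_iff mset.simps(2))
  then show ?thesis by (auto simp: entries_def)
qed

lemma row_insert_append:
  "\<forall>y\<in>set r. y \<le> x \<Longrightarrow> row_insert x (r # rs) = (r @ [x]) # rs"
  by (simp add: bump_append)

lemma row_insert_replace:
  "i < length r \<Longrightarrow> x < r ! i \<Longrightarrow> \<forall>j<i. r ! j \<le> x \<Longrightarrow>
    row_insert x (r # rs) = r[i := x] # row_insert (r ! i) rs"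
  by (simp add: bump_replace)

lemma top_row_row_insert: "top_row (row_insert x T) = fst (bump x (top_row T))"
  by (cases T) (auto split: prod.splits option.splits)

lemma sorted_replace:
  assumes "sorted_wrt (<) (r :: nat list)" "i < length r"
    "\<forall>j<i. r ! j < x" "\<forall>j<length r. i < j \<longrightarrow> x < r ! j"
  shows "sorted_wrt (<) (r[i := x])"
  using assms by (auto simp: sorted_wrt_iff_nth_less nth_list_update)

text \<open>The entry bumped from column \<open>i\<close> enters the next row in a column \<open>\<le> i\<close>.\<close>

lemma above_replace_bump:
  assumes "above r s" "sorted_wrt (<) r" "i < length r" "x < r ! i"
  shows "above (r[i := x]) (fst (bump (r ! i) s))"
proof (cases rule: bump_cases[of "r ! i" s])
  case append
  have len: "length s \<le> i"
  proof (rule ccontr)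
    assume "\<not> length s \<le> i"
    then have "r ! i < s ! i" "s ! i \<le> r ! i" using assms append by (auto simp: above_def)
    then show False by simp
  qed
  then have "r[i := x] ! length s < r ! i"
    using assms by (cases "length s = i") (auto simp: sorted_wrt_iff_nth_less)
  moreover have "r[i := x] ! j < s ! j" if "j < length s" for j
    using assms that len by (auto simp: above_def)
  ultimately show ?thesis
    using append len assms(3) by (auto simp: above_def nth_append less_Suc_eq)
next
  case (replace k)
  have len: "length s \<le> length r" using assms by (simp add: above_def)
  have "k \<le> i"
  proof (rule ccontr)
    assume "\<not> k \<le> i"
    then have "r ! i < s ! i" "s ! i \<le> r ! i" using assms replace by (auto simp: above_def)
    then show False by simp
  qed
  then have "r[i := x] ! k < r ! i"
    using assms by (cases "k = i") (auto simp: sorted_wrt_iff_nth_less)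
  moreover have "r[i := x] ! j < s ! j" if "j < length s" for j
  proof -
    have "r ! j < s ! j" using assms that by (auto simp: above_def)
    then show ?thesis using assms by (cases "j = i") auto
  qed
  ultimately show ?thesis
    using replace len by (auto simp: above_def nth_list_update)
qed

text \<open>By distinctness the bumped entry does not occur in the rows below, so the induction
  hypothesis applies to it; \<open>above_replace_bump\<close> keeps the columns increasing across
  the two rows concerned.\<close>

lemma tab_row_insert:
  assumes "tab T" "distinct (concat T)" "x \<notin> entries T"
  shows "tab (row_insert x T) \<and> grow (shape T) (shape (row_insert x T))"
  using assms
proof (induction T arbitrary: x)
  case Nil
  then show ?case by simp
next
  case (Cons r rs)
  show ?case
  proof (cases rule: bump_cases[of x r])
    case append
    then have "\<forall>y\<in>set r. y < x" using Cons.prems by (metis UnI1 entries_simps(2) le_neq_implies_less)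
    then show ?thesis
      using Cons.prems append by (auto simp: sorted_wrt_append above_def nth_append)
  next
    case (replace i)
    have less: "\<forall>j<i. r ! j < x"
    proof safe
      fix j assume "j < i"
      then have "r ! j \<le> x" "r ! j \<in> set r" using replace by auto
      then show "r ! j < x" using Cons.prems by (auto simp: le_less)
    qed
    have "r ! i \<in> set r" using replace by simp
    then have "r ! i \<notin> entries rs" using Cons.prems(2) by (auto simp: entries_def)
    then have IH: "tab (row_insert (r ! i) rs)" "grow (shape rs) (shape (row_insert (r ! i) rs))"
      using Cons by auto
    have sorted: "sorted_wrt (<) r" using Cons.prems by simp
    have "\<forall>j<length r. i < j \<longrightarrow> x < r ! j"
      using sorted replace(3) by (meson less_trans sorted_wrt_iff_nth_less)
    then have "sorted_wrt (<) (r[i := x])"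
      using sorted_replace sorted replace(1) less by blast
    moreover have "above (r[i := x]) (top_row (row_insert (r ! i) rs))"
      unfolding top_row_row_insert using Cons.prems replace by (intro above_replace_bump) auto
    moreover have "row_insert x (r # rs) = r[i := x] # row_insert (r ! i) rs"
      using replace by (simp add: row_insert_replace)
    ultimately show ?thesis using IH Cons.prems by auto
  qed
qed

text \<open>Equal shapes force both insertions to append or both to bump in the top row. In the
  latter case the induction identifies the bumped entries and the lower rows, and the columns must
  agree: if \<open>i1 < i2\<close>, then \<open>x2\<close> equals \<open>r1 ! i2\<close>, which
  exceeds \<open>r1 ! i1 = r2 ! i2\<close>, although \<open>x2\<close> bumps the latter.\<close>

lemma row_insert_inject:
  assumes "tab S1" "tab S2" "shape S1 = shape S2" "row_insert x1 S1 = row_insert x2 S2"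
  shows "x1 = x2 \<and> S1 = S2"
  using assms
proof (induction S1 arbitrary: x1 x2 S2)
  case Nil
  then show ?case by (cases S2) auto
next
  case (Cons r1 q1)
  then obtain r2 q2 where S2: "S2 = r2 # q2" by (cases S2) auto
  have len: "length r1 = length r2" "shape q1 = shape q2" using Cons.prems S2 by auto
  have sorted: "sorted_wrt (<) r1" "sorted_wrt (<) r2" using Cons.prems S2 by auto
  note eq = Cons.prems(4)[unfolded S2]
  show ?case
  proof (cases rule: bump_cases[of x1 r1])
    case append1: append
    show ?thesis
    proof (cases rule: bump_cases[of x2 r2])
      case append2: append
      then show ?thesis using eq append1 S2 by simp
    next
      case (replace i2)
      then have "r1 @ [x1] = r2[i2 := x2]" using eq append1 by simp
      then have "length (r1 @ [x1]) = length (r2[i2 := x2])" by simp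
      then show ?thesis using len by simp
    qed
  next
    case replace1: (replace i1)
    show ?thesis
    proof (cases rule: bump_cases[of x2 r2])
      case append
      then have "r1[i1 := x1] = r2 @ [x2]" using eq replace1 by simp
      then have "length (r1[i1 := x1]) = length (r2 @ [x2])" by simp
      then show ?thesis using len by simp
    next
      case replace2: (replace i2)
      have row: "r1[i1 := x1] = r2[i2 := x2]"
        and rest: "row_insert (r1 ! i1) q1 = row_insert (r2 ! i2) q2"
        using eq replace1 replace2 by simp_all
      have IH: "r1 ! i1 = r2 ! i2 \<and> q1 = q2"
        using Cons.IH[OF _ _ len(2) rest] Cons.prems S2 by simp
      have "\<not> i1 < i2"
      proof
        assume "i1 < i2"
        then have "r1 ! i1 < r1 ! i2" using sorted replace2 len by (auto simp: sorted_wrt_iff_nth_less)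
        also have "r1 ! i2 = r1[i1 := x1] ! i2" using \<open>i1 < i2\<close> by simp
        also have "\<dots> = x2" using row replace2 by simp
        finally show False using replace2 IH by simp
      qed
      moreover have "\<not> i2 < i1"
      proof
        assume "i2 < i1"
        then have "r2 ! i2 < r2 ! i1" using sorted replace1 len by (auto simp: sorted_wrt_iff_nth_less)
        also have "r2 ! i1 = r2[i2 := x2] ! i1" using \<open>i2 < i1\<close> by simp
        also have "\<dots> = x1" using row replace1 by (metis nth_list_update_eq)
        finally show False using replace1 IH by simp
      qed
      ultimately have i: "i1 = i2" by simp
      then have "x1 = x2" using row replace1 replace2 by (metis nth_list_update_eq)
      moreover have "r1 = r2" using row i IH
        by (metis list_update_id list_update_overwrite)
      ultimately show ?thesis using IH S2 by simp
    qed
  qed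
qed

text \<open>Reverse bumping with \<open>y\<close> replaces the rightmost entry smaller than
  \<open>y\<close>; the column \<open>k\<close> bounds its place from the left.\<close>

lemma ex_last_less:
  fixes r :: "nat list"
  assumes "k < length r" "r ! k < y"
  obtains i where "k \<le> i" "i < length r" "r ! i < y" "\<forall>j<length r. i < j \<longrightarrow> y \<le> r ! j"
proof -
  define P where "P i \<longleftrightarrow> i < length r \<and> r ! i < y" for i
  have P: "P k" "\<forall>i. P i \<longrightarrow> i \<le> length r" using assms by (auto simp: P_def)
  show thesis
  proof (rule that[of "GREATEST i. P i"])
    show "k \<le> (GREATEST i. P i)" using P Greatest_le_nat by blast
    have "P (GREATEST i. P i)" using P GreatestI_nat by blast
    then show "(GREATEST i. P i) < length r" "r ! (GREATEST i. P i) < y" by (auto simp: P_def)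
    show "\<forall>j<length r. (GREATEST i. P i) < j \<longrightarrow> y \<le> r ! j"
      using P Greatest_le_nat[of P _ "length r"] by (meson P_def leD leI)
  qed
qed

text \<open>If \<open>y\<close> lands in column \<open>k\<close> of \<open>s\<close>, then
  \<open>r ! k < y\<close>, so the rightmost entry of \<open>r\<close> below \<open>y\<close> sits
  in a column \<open>i \<ge> k\<close>. From column \<open>k\<close> on, the entries of
  \<open>s\<close> exceed \<open>y\<close>, hence \<open>y\<close> may stand above them in column
  \<open>i\<close>.\<close>

lemma row_unbump:
  assumes above: "above r (fst (bump y s))" and r: "sorted_wrt (<) r" "y \<notin> set r"
    and s: "sorted_wrt (<) s" "y \<notin> set s" "length s \<le> length r"
  obtains i where "i < length r" "r ! i < y" "sorted_wrt (<) (r[i := y])" "above (r[i := y]) s"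
proof -
  obtain k where k: "k < length r" "r ! k < y" "k \<le> length s" "\<forall>j<length s. k \<le> j \<longrightarrow> y < s ! j"
    "\<forall>j<length s. r ! j < s ! j"
  proof (cases rule: bump_cases[of y s])
    case append
    then have "above r (s @ [y])" using above by simp
    then show ?thesis using that[of "length s"] by (auto simp: above_def nth_append less_Suc_eq)
  next
    case (replace k)
    then have ab: "above r (s[k := y])" using above by simp
    have "y < s ! j" if "j < length s" "k \<le> j" for j
      using that replace s by (metis le_neq_implies_less less_trans sorted_wrt_iff_nth_less)
    moreover have "r ! j < s ! j" if "j < length s" for j
      using ab replace that by (cases "j = k") (auto simp: above_def dest!: spec[of _ j])
    ultimately show ?thesis using that[of k] replace ab s
      by (auto simp: above_def dest!: spec[of _ k])
  qed
  obtain i where i: "k \<le> i" "i < length r" "r ! i < y" "\<forall>j<length r. i < j \<longrightarrow> y \<le> r ! j"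
    using k ex_last_less by blast
  show thesis
  proof (rule that[of i])
    have "\<forall>j<length r. i < j \<longrightarrow> y < r ! j" using i r by (metis le_neq_implies_less nth_mem)
    moreover have "\<forall>j<i. r ! j < y" using i r by (meson less_trans sorted_wrt_iff_nth_less)
    ultimately show "sorted_wrt (<) (r[i := y])" using sorted_replace r i by blast
    show "above (r[i := y]) s"
      using k i s by (auto simp: above_def nth_list_update)
  qed (use i in auto)
qed

lemma ex_reverse_insert:
  assumes "tab T" "distinct (concat T)" "is_partition la" "grow la (shape T)"
  shows "\<exists>S x. tab S \<and> shape S = la \<and> row_insert x S = T"
  using assms
proof (induction T arbitrary: la)
  case Nil
  then show ?case by (cases la) auto
next
  case (Cons r rs)
  show ?case
  proof (cases la)
    case Nil
    then obtain a where "r = [a]" "rs = []" using Cons.prems by (auto simp: length_Suc_conv shape_def)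
    then have "row_insert a [] = r # rs" by simp
    then show ?thesis using Nil by (metis shape_simps(1) tab.simps(1))
  next
    case (Cons m mu)
    then consider (here) "length r = Suc m" "shape rs = mu" | (below) "length r = m" "grow mu (shape rs)"
      using Cons.prems by auto
    then show ?thesis
    proof cases
      case here
      define r' where "r' = butlast r"
      obtain x where r: "r = r' @ [x]" unfolding r'_def using here
        by (metis append_butlast_last_id list.size(3) nat.distinct(1))
      \<comment> \<open>Since \<open>la\<close> is a partition, the removed box is a corner: the
        shortened row is nonempty and still covers the row below.\<close>
      have m: "0 < m" "rs \<noteq> [] \<longrightarrow> length (top_row rs) \<le> m"
        using Cons.prems(3) Cons here by (auto simp: is_partition_Cons_iff length_top_row shape_def)
      have len: "length r' = m" using here r by simp
      have "tab (r' # rs)"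
        using Cons.prems(1) m len r
        by (cases "rs = []") (auto simp: above_def sorted_wrt_append nth_append)
      moreover have "row_insert x (r' # rs) = r # rs"
        using Cons.prems(1) r by (subst row_insert_append) (auto simp: sorted_wrt_append)
      moreover have "shape (r' # rs) = la" using Cons here len by simp
      ultimately show ?thesis by blast
    next
      case below
      have "is_partition mu" using Cons.prems Cons by (simp add: is_partition_Cons_iff)
      then obtain S y where S: "tab S" "shape S = mu" "row_insert y S = rs"
        using Cons.IH[of mu] Cons.prems below by auto
      have dist: "distinct (concat S)" "y \<notin> entries S"
        using Cons.prems(2) S distinct_row_insert[of y S] by auto
      have y: "y \<in> entries rs" using S entries_row_insert by blast
      obtain i where i: "i < length r" "r ! i < y" "sorted_wrt (<) (r[i := y])"
        "above (r[i := y]) (top_row S)"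
      proof (rule row_unbump[of r y "top_row S"])
        show "above r (fst (bump y (top_row S)))"
          using Cons.prems(1) S by (auto simp flip: top_row_row_insert)
        show "sorted_wrt (<) r" using Cons.prems by simp
        show "y \<notin> set r" using Cons.prems(2) y by (auto simp: entries_def)
        show "sorted_wrt (<) (top_row S)" using S by (cases S) auto
        show "y \<notin> set (top_row S)" using dist by (cases S) auto
        show "length (top_row S) \<le> length r"
          using Cons.prems(3) Cons below S(2)
          by (auto simp: is_partition_Cons_iff length_top_row shape_def)
      qed
      have "\<forall>j<i. r[i := y] ! j \<le> r ! i"
        using Cons.prems(1) i by (auto simp: sorted_wrt_iff_nth_less less_imp_le)
      then have "row_insert (r ! i) (r[i := y] # S) = r # rs"
        using i S by (subst row_insert_replace[of i]) auto
      moreover have "tab (r[i := y] # S)" using i S by auto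
      moreover have "shape (r[i := y] # S) = la" using Cons below S by simp
      ultimately show ?thesis by blast
    qed
  qed
qed

section \<open>Insertion and its inverse on tableaux with distinct positive entries\<close>

lemma zero_notin_shape: "tab T \<Longrightarrow> 0 \<notin> set (shape T)"
  by (simp add: tab_iff is_partition_def)

lemma is_tableau_row_insert:
  assumes "is_tableau T" "x \<notin> entries T" "0 < x"
  shows "is_tableau (row_insert x T)" "adds_box (shape T) (shape (row_insert x T))"
proof -
  have tab: "tab (row_insert x T)" "grow (shape T) (shape (row_insert x T))"
    using assms tab_row_insert by (auto simp: is_tableau_iff)
  then show "is_tableau (row_insert x T)"
    using assms by (auto simp: is_tableau_iff distinct_row_insert entries_row_insert)
  show "adds_box (shape T) (shape (row_insert x T))"
    using tab assms by (simp add: adds_box_grow zero_notin_shape is_tableau_iff)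
qed

lemma is_tableau_row_insertD:
  assumes "tab S" "is_tableau (row_insert x S)"
  shows "is_tableau S" "x \<notin> entries S" "0 < x"
  using assms by (auto simp: is_tableau_iff distinct_row_insert entries_row_insert)

lemma ex_is_tableau_row_insert:
  assumes "is_tableau T" "is_partition la" "adds_box la (shape T)"
  obtains S x where "is_tableau S" "shape S = la" "row_insert x S = T" "x \<notin> entries S" "0 < x"
proof -
  have "grow la (shape T)"
    using assms zero_notin_shape[of T]
    by (subst (asm) adds_box_grow) (auto simp: is_tableau_iff is_partition_def)
  then obtain S x where "tab S" "shape S = la" "row_insert x S = T"
    using ex_reverse_insert assms by (metis is_tableau_iff)
  then show thesis using that is_tableau_row_insertD assms(1) by metis
qed

text \<open>Evaluates the definite description in \<open>reverse_insert\<close>; its uniqueness part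
  is \<open>row_insert_inject\<close>.\<close>

lemma reverse_insert_row_insert:
  assumes "is_tableau S"
  shows "reverse_insert (shape S) (row_insert x S) = S"
  unfolding reverse_insert_def
  using assms row_insert_inject by (intro the_equality) (auto simp: is_tableau_iff)

subsection \<open>Adding and deleting the largest entry\<close>

text \<open>A relation instead of a function, because the row that receives \<open>k\<close> is
  dictated by the shape of the result.\<close>

fun extends :: "nat \<Rightarrow> tableau \<Rightarrow> tableau \<Rightarrow> bool" where
  "extends k [] S = (S = [[k]])"
| "extends k (r # rs) [] = False"
| "extends k (r # rs) (s # ss) = (s = r @ [k] \<and> ss = rs \<or> s = r \<and> extends k rs ss)"

text \<open>Rows that become empty are dropped, since the shape of a tableau has no part 0.\<close>

definition delete :: "nat \<Rightarrow> tableau \<Rightarrow> tableau" where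
  "delete k T = filter (\<lambda>r. r \<noteq> []) (map (filter (\<lambda>y. y \<noteq> k)) T)"

lemma put_in_new_box_Cons:
  "put_in_new_box (l # la) k (r # rs) =
    map (\<lambda>j. if j < length r then r ! j else k) [0..<l] # put_in_new_box la k rs"
  by (simp add: put_in_new_box_def upt_conv_Cons mem_boxes comp_def flip: map_Suc_upt del: upt_Suc)

lemma put_in_new_box_shape: "put_in_new_box (shape T) k T = T"
  by (auto simp: put_in_new_box_def boxes_def shape_def intro!: nth_equalityI)

lemma put_in_new_box_extends: "extends k T S \<Longrightarrow> put_in_new_box (shape S) k T = S"
proof (induction k T S rule: extends.induct)
  case (1 k S)
  then show ?case by (simp add: put_in_new_box_def mem_boxes)
next
  case (2 k r rs)
  then show ?case by simp
next
  case (3 k r rs s ss)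
  then show ?case
    by (auto simp: put_in_new_box_Cons put_in_new_box_shape nth_append intro!: nth_equalityI
        simp del: upt_Suc)
qed

lemma ex_extends: "grow (shape T) la \<Longrightarrow> \<exists>S. extends k T S \<and> shape S = la"
proof (induction T arbitrary: la)
  case Nil
  then show ?case by simp
next
  case (Cons r rs)
  then obtain l la' where la: "la = l # la'" by (cases la) auto
  then consider "l = Suc (length r)" "la' = shape rs" | "l = length r" "grow (shape rs) la'"
    using Cons.prems by auto
  then show ?case
  proof cases
    case 1
    then show ?thesis using la by (intro exI[of _ "(r @ [k]) # rs"]) simp
  next
    case 2
    then obtain S where "extends k rs S \<and> shape S = la'" using Cons.IH by blast
    then show ?thesis using la 2 by (intro exI[of _ "r # S"]) simp
  qed
qed

lemma grow_extends: "extends k T S \<Longrightarrow> grow (shape T) (shape S)"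
  by (induction k T S rule: extends.induct) auto

lemma mset_extends: "extends k T S \<Longrightarrow> mset (concat S) = add_mset k (mset (concat T))"
  by (induction k T S rule: extends.induct) auto

lemma entries_extends: "extends k T S \<Longrightarrow> entries S = insert k (entries T)"
  unfolding entries_def by (metis mset_extends set_mset_mset set_mset_add_mset_insert)

lemma distinct_extends:
  assumes "extends k T S"
  shows "distinct (concat S) \<longleftrightarrow> distinct (concat T) \<and> k \<notin> entries T"
proof -
  have "distinct (concat S) \<longleftrightarrow> distinct (k # concat T)"
    using assms by (metis mset_extends mset_eq_imp_distinct_iff mset.simps(2))
  then show ?thesis by (auto simp: entries_def)
qed

lemma top_row_extends: "extends k T S \<Longrightarrow> top_row S = top_row T \<or> top_row S = top_row T @ [k]"
  by (cases "(k, T, S)" rule: extends.cases) auto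

text \<open>A number exceeding all others respects the order at the end of any row; that its box
  leaves a partition is the assumption on \<open>shape S\<close>.\<close>

lemma tab_extends:
  assumes "extends k T S" "tab T" "\<forall>y\<in>entries T. y < k" "is_partition (shape S)"
  shows "tab S"
  using assms
proof (induction k T S rule: extends.induct)
  case (1 k S)
  then show ?case by simp
next
  case (2 k r rs)
  then show ?case by simp
next
  case (3 k r rs s ss)
  show ?case
  proof (cases "s = r @ [k] \<and> ss = rs")
    case True
    then show ?thesis using 3 by (auto simp: sorted_wrt_append above_def nth_append)
  next
    case False
    then have *: "s = r" "extends k rs ss" using 3 by auto
    have "length (top_row ss) \<le> length r"
      using 3 * by (auto simp: is_partition_Cons_iff length_top_row shape_def)
    then have "above r (top_row ss)"
      using top_row_extends[OF *(2)] 3 by (auto simp: above_def nth_append less_Suc_eq)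
    then show ?thesis using * 3 by (auto simp: is_partition_Cons_iff)
  qed
qed

lemma filter_neq_id: "k \<notin> set r \<Longrightarrow> filter (\<lambda>y. y \<noteq> k) r = r"
  by (auto simp: filter_id_conv)

lemma delete_id: "k \<notin> entries T \<Longrightarrow> [] \<notin> set T \<Longrightarrow> delete k T = T"
  by (induction T) (auto simp: delete_def filter_neq_id)

lemma tab_no_Nil: "tab T \<Longrightarrow> [] \<notin> set T"
  by (induction T) auto

lemma delete_extends:
  "extends k T S \<Longrightarrow> k \<notin> entries T \<Longrightarrow> [] \<notin> set T \<Longrightarrow> delete k S = T"
proof (induction k T S rule: extends.induct)
  case (3 k r rs s ss)
  then show ?case using delete_id[of k rs] by (auto simp: delete_def filter_neq_id)
qed (auto simp: delete_def)

lemma above_appendD: "above r (s @ t) \<Longrightarrow> above r s"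
proof -
  assume ab: "above r (s @ t)"
  have "r ! j < s ! j" if "j < length s" for j
    using ab that by (auto simp: above_def nth_append dest!: spec[of _ j])
  then show "above r s" using ab by (simp add: above_def)
qed

text \<open>The largest entry can have no neighbour to its right or below, so it occupies a corner.
  If it is alone in its row, there is no further row and the row disappears.\<close>

lemma extends_delete:
  assumes "tab S" "distinct (concat S)" "k \<in> entries S" "\<forall>y\<in>entries S. y \<le> k"
  shows "\<exists>T. extends k T S \<and> tab T"
  using assms
proof (induction S)
  case Nil
  then show ?case by simp
next
  case (Cons s ss)
  show ?case
  proof (cases "k \<in> set s")
    case True
    then obtain r t where s: "s = r @ k # t" by (meson split_list)
    have t: "t = []"
    proof (cases t)
      case (Cons a u)
      then have "k < a" "a \<le> k" using s Cons.prems by (auto simp: sorted_wrt_append)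
      then show ?thesis by simp
    qed
    have top: "length (top_row ss) \<le> length r"
    proof (rule ccontr)
      assume "\<not> length (top_row ss) \<le> length r"
      then have "s ! length r < top_row ss ! length r" "top_row ss ! length r \<in> set (top_row ss)"
        using Cons.prems(1) by (auto simp: above_def)
      moreover have "set (top_row ss) \<subseteq> entries ss" by (cases ss) auto
      ultimately have "s ! length r < top_row ss ! length r" "top_row ss ! length r \<in> entries ss"
        by blast+
      then have "top_row ss ! length r \<le> k" using Cons.prems(4) by auto
      moreover have "s ! length r = k" using s by simp
      ultimately show False using \<open>s ! length r < top_row ss ! length r\<close> by simp
    qed
    show ?thesis
    proof (cases "r = []")
      case True
      then have "ss = []" using top Cons.prems(1) by (cases ss) auto
      then show ?thesis using True s t by (intro exI[of _ "[]"]) simp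
    next
      case False
      have "tab (r # ss)"
        using Cons.prems(1) s t top False by (auto simp: above_def sorted_wrt_append nth_append)
      then show ?thesis using s t by (intro exI[of _ "r # ss"]) simp
    qed
  next
    case False
    then obtain T where T: "extends k T ss" "tab T" using Cons by auto
    have "above s (top_row T)"
      using top_row_extends[OF T(1)] Cons.prems(1) above_appendD by auto
    then show ?thesis using T Cons.prems(1) by (intro exI[of _ "s # T"]) auto
  qed
qed

lemma is_tableau_delete:
  assumes "is_tableau S" "k \<in> entries S" "\<forall>y\<in>entries S. y \<le> k"
  shows "is_tableau (delete k S)" "extends k (delete k S) S" "entries (delete k S) = entries S - {k}"
proof -
  obtain T where T: "extends k T S" "tab T"
    using assms extends_delete[of S k] by (auto simp: is_tableau_iff)
  have dist: "distinct (concat T)" "k \<notin> entries T"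
    using distinct_extends[OF T(1)] assms by (auto simp: is_tableau_iff)
  have eq: "delete k S = T" using delete_extends T dist tab_no_Nil by blast
  show "is_tableau (delete k S)"
    using eq T dist assms entries_extends[OF T(1)] by (simp add: is_tableau_iff)
  show "extends k (delete k S) S" using eq T by simp
  show "entries (delete k S) = entries S - {k}" using eq dist entries_extends[OF T(1)] by auto
qed

lemma ex_is_tableau_extends:
  assumes "is_tableau T" "\<forall>y\<in>entries T. y < k" "0 < k" "is_partition la" "adds_box (shape T) la"
  obtains S where "is_tableau S" "shape S = la" "entries S = insert k (entries T)" "delete k S = T"
proof -
  have "grow (shape T) la"
    using assms by (subst (asm) adds_box_grow) (auto simp: is_tableau_iff is_partition_def zero_notin_shape)
  then obtain S where S: "extends k T S" "shape S = la" using ex_extends by blast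
  have k: "k \<notin> entries T" using assms by auto
  have "tab S" using tab_extends[OF S(1)] assms S by (auto simp: is_tableau_iff)
  then have "is_tableau S"
    using assms k distinct_extends[OF S(1)] entries_extends[OF S(1)] by (auto simp: is_tableau_iff)
  moreover have "delete k S = T"
    using delete_extends[OF S(1) k] tab_no_Nil assms by (auto simp: is_tableau_iff)
  ultimately show thesis using that S entries_extends by metis
qed

subsection \<open>Histories\<close>

text \<open>
  A history lists, from left to right, what the steps do to the filling when it is read from right
  to left: \<open>None\<close> introduces the next number and \<open>Some x\<close> ejects the number \<open>x\<close>.
\<close>

type_synonym history = "nat option list"

definition introduced :: "history \<Rightarrow> nat" where
  "introduced h = count_list h None"

text \<open>The head of a history is its leftmost step, hence the last one performed when filling.
  The tail therefore decides which number comes next and which may be ejected.\<close>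

fun present :: "history \<Rightarrow> nat set" where
  "present [] = {}"
| "present (None # h) = insert (Suc (introduced h)) (present h)"
| "present (Some x # h) = present h - {x}"

fun valid :: "history \<Rightarrow> bool" where
  "valid [] = True"
| "valid (None # h) = valid h"
| "valid (Some x # h) = (x \<in> present h \<and> valid h)"

text \<open>\<open>T\<close> fills the leftmost shape. On the way to the right each event is undone:
  the newest number is deleted, and an ejected number is inserted again.\<close>

fun trace :: "history \<Rightarrow> tableau \<Rightarrow> tableau list" where
  "trace [] T = [T]"
| "trace (None # h) T = T # trace h (delete (Suc (introduced h)) T)"
| "trace (Some x # h) T = T # trace h (row_insert x T)"

definition filled_by :: "history \<Rightarrow> tableau \<Rightarrow> bool" where
  "filled_by h T \<longleftrightarrow> valid h \<and> is_tableau T \<and> entries T = present h"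

lemma introduced_simps [simp]:
  "introduced [] = 0" "introduced (None # h) = Suc (introduced h)"
  "introduced (Some x # h) = introduced h"
  by (simp_all add: introduced_def)

lemma present_subset: "present h \<subseteq> {1..introduced h}"
  by (induction h rule: present.induct) auto

lemma finite_present [simp]: "finite (present h)"
  using finite_subset[OF present_subset] by blast

lemma Suc_introduced_notin: "Suc (introduced h) \<notin> present h"
  using present_subset[of h] by auto

text \<open>An introduction raises both sides by 2; an ejection removes one present number and adds
  one step. For complete histories this makes the number of introductions half the length.\<close>

lemma card_present: "valid h \<Longrightarrow> card (present h) + length h = 2 * introduced h"
proof (induction h rule: valid.induct)
  case (3 x h)
  then have "Suc (card (present h - {x})) = card (present h)" by (intro card.remove[symmetric] | simp)+
  then show ?case using 3 by simp
qed (auto simp: Suc_introduced_notin)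

lemma filled_by_Nil: "filled_by [] T \<longleftrightarrow> T = []"
proof
  assume "filled_by [] T"
  then show "T = []" by (cases T) (auto simp: filled_by_def is_tableau_iff)
qed (simp add: filled_by_def is_tableau_iff)

lemma filled_by_None:
  assumes "filled_by (None # h) T"
  shows "filled_by h (delete (Suc (introduced h)) T)"
    and "extends (Suc (introduced h)) (delete (Suc (introduced h)) T) T"
proof -
  have T: "is_tableau T" "Suc (introduced h) \<in> entries T"
    "\<forall>y\<in>entries T. y \<le> Suc (introduced h)"
    using assms present_subset[of h] by (auto simp: filled_by_def)
  show "filled_by h (delete (Suc (introduced h)) T)"
    using is_tableau_delete[OF T] assms Suc_introduced_notin[of h] by (auto simp: filled_by_def)
  show "extends (Suc (introduced h)) (delete (Suc (introduced h)) T) T"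
    by (rule is_tableau_delete[OF T])
qed

lemma filled_by_Some:
  assumes "filled_by (Some x # h) T"
  shows "filled_by h (row_insert x T)" "adds_box (shape T) (shape (row_insert x T))"
    and "x \<notin> entries T"
proof -
  have x: "x \<in> present h" "x \<notin> entries T" "is_tableau T" using assms by (auto simp: filled_by_def)
  then have "0 < x" using present_subset[of h] by auto
  then show "filled_by h (row_insert x T)" "adds_box (shape T) (shape (row_insert x T))"
    using assms is_tableau_row_insert[of T x] x
    by (auto simp: filled_by_def entries_row_insert insert_absorb)
  show "x \<notin> entries T" by fact
qed

lemma trace_eq_Cons: "trace h T = T # tl (trace h T)"
  by (cases "(h, T)" rule: trace.cases) auto

lemma hd_trace [simp]: "hd (trace h T) = T"
  by (metis trace_eq_Cons list.sel(1))

lemma shapes_trace: obtains L where "map shape (trace h T) = shape T # L"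
  by (metis trace_eq_Cons list.map(2))

lemma length_trace: "length (trace h T) = Suc (length h)"
  by (induction h T rule: trace.induct) auto

text \<open>An ejected number still counts as used, because it occurs in a filling further right.
  This is what makes \<open>smallest_unused\<close> the next number in order.\<close>

lemma entries_trace: "filled_by h T \<Longrightarrow> (\<Union>T\<in>set (trace h T). entries T) = {1..introduced h}"
proof (induction h T rule: trace.induct)
  case (1 T)
  then show ?case by (simp add: filled_by_Nil)
next
  case (2 h T)
  have "(\<Union>T\<in>set (trace (None # h) T). entries T) = entries T \<union> {1..introduced h}"
    using 2 filled_by_None by simp
  also have "\<dots> = insert (Suc (introduced h)) (present h \<union> {1..introduced h})"
    using 2 by (simp add: filled_by_def)
  also have "\<dots> = {1..introduced (None # h)}" using present_subset[of h] by auto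
  finally show ?case .
next
  case (3 x h T)
  have "(\<Union>T\<in>set (trace (Some x # h) T). entries T) = entries T \<union> {1..introduced h}"
    using 3 filled_by_Some by simp
  also have "\<dots> = {1..introduced h}"
    using present_subset[of h] 3 by (auto simp: filled_by_def)
  finally show ?case by simp
qed

lemma smallest_unused_trace:
  assumes "filled_by h T"
  shows "smallest_unused (trace h T) = Suc (introduced h)"
proof -
  have *: "(\<forall>T\<in>set (trace h T). k \<notin> entries T) \<longleftrightarrow> k \<notin> {1..introduced h}" for k
    using entries_trace[OF assms] by blast
  show ?thesis unfolding smallest_unused_def * by (rule Least_equality) auto
qed

lemma adds_box_filled:
  assumes "filled_by h T" "filled_by h' T'"
  shows "adds_box (shape T) (shape T') \<longleftrightarrow> grow (shape T) (shape T')"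
  using assms by (intro adds_box_grow zero_notin_shape) (auto simp: filled_by_def is_tableau_iff)

lemma adds_box_None:
  assumes "filled_by (None # h) T"
  shows "adds_box (shape (delete (Suc (introduced h)) T)) (shape T)"
  using filled_by_None[OF assms] adds_box_filled assms grow_extends by blast

lemma fillings_trace: "filled_by h T \<Longrightarrow> fillings (map shape (trace h T)) = trace h T"
proof (induction h T rule: trace.induct)
  case (1 T)
  then show ?case by (simp add: filled_by_Nil)
next
  case (2 h T)
  let ?D = "delete (Suc (introduced h)) T"
  note D = filled_by_None[OF "2.prems"]
  obtain L where L: "map shape (trace h ?D) = shape ?D # L" by (rule shapes_trace)
  then have "fillings (shape ?D # L) = trace h ?D" using "2.IH" D by simp
  then show ?case
    using L adds_box_None[OF "2.prems"] smallest_unused_trace[OF D(1)] put_in_new_box_extends[OF D(2)]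
    by (simp add: Let_def)
next
  case (3 x h T)
  let ?I = "row_insert x T"
  note I = filled_by_Some[OF "3.prems"]
  obtain L where L: "map shape (trace h ?I) = shape ?I # L" by (rule shapes_trace)
  then have "fillings (shape ?I # L) = trace h ?I" using "3.IH" I by simp
  moreover have "\<not> adds_box (shape ?I) (shape T)"
    using I(2) adds_box_filled[OF "3.prems" I(1)] adds_box_filled[OF I(1) "3.prems"] grow_asym by simp
  moreover have "reverse_insert (shape T) ?I = T"
    using "3.prems" by (intro reverse_insert_row_insert) (auto simp: filled_by_def)
  ultimately show ?case using L by (simp add: Let_def)
qed

section \<open>Oscillating tableaux as the shapes of traces\<close>

fun osc :: "nat list list \<Rightarrow> bool" where
  "osc [] = False"
| "osc [la] = (la = [])"
| "osc (la # mu # L) = (is_partition la \<and> (adds_box la mu \<or> adds_box mu la) \<and> osc (mu # L))"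

lemma osc_iff:
  "osc L \<longleftrightarrow> L \<noteq> [] \<and> (\<forall>la\<in>set L. is_partition la) \<and> last L = [] \<and>
     (\<forall>i<length L - 1. adds_box (L ! i) (L ! Suc i) \<or> adds_box (L ! Suc i) (L ! i))"
  by (induction L rule: osc.induct)
    (auto simp: is_partition_Nil nth_Cons less_Suc_eq_0_disj split: nat.splits)

lemma oscillating_tableaux_iff:
  "L \<in> oscillating_tableaux m \<longleftrightarrow> length L = Suc m \<and> osc L \<and> hd L = []"
proof -
  have steps: "(\<forall>i\<in>{1..m}. P (i - 1) i) \<longleftrightarrow> (\<forall>i<m. P i (Suc i))" for P
    unfolding image_Suc_lessThan[symmetric] by auto
  show ?thesis
  proof (cases "length L = Suc m")
    case True
    then have "L \<noteq> []" by auto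
    then show ?thesis using True
      unfolding oscillating_tableaux_def osc_iff
      using steps[of "\<lambda>i j. adds_box (L ! i) (L ! j) \<or> adds_box (L ! j) (L ! i)"]
      by (auto simp: hd_conv_nth last_conv_nth)
  qed (simp add: oscillating_tableaux_def)
qed

lemma is_partition_filled: "filled_by h T \<Longrightarrow> is_partition (shape T)"
  by (simp add: filled_by_def is_tableau_def)

lemma osc_trace: "filled_by h T \<Longrightarrow> osc (map shape (trace h T))"
proof (induction h T rule: trace.induct)
  case (1 T)
  then show ?case by (simp add: filled_by_Nil)
next
  case (2 h T)
  let ?D = "delete (Suc (introduced h)) T"
  obtain L where L: "map shape (trace h ?D) = shape ?D # L" by (rule shapes_trace)
  then have "osc (shape ?D # L)" using 2 filled_by_None by simp
  then show ?case using L adds_box_None[OF "2.prems"] is_partition_filled[OF "2.prems"] by simp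
next
  case (3 x h T)
  let ?I = "row_insert x T"
  obtain L where L: "map shape (trace h ?I) = shape ?I # L" by (rule shapes_trace)
  then have "osc (shape ?I # L)" using 3 filled_by_Some by simp
  then show ?case using L filled_by_Some[OF "3.prems"] is_partition_filled[OF "3.prems"] by simp
qed

text \<open>Stated for suffixes of oscillating tableaux, whose first shape is arbitrary. A step up
  from \<open>la\<close> is answered by unbumping, a step down by placing a new largest number in
  the additional box of \<open>la\<close>.\<close>

lemma ex_trace:
  "osc L \<Longrightarrow> \<exists>h T. filled_by h T \<and> map shape (trace h T) = L"
proof (induction L rule: osc.induct)
  case 1
  then show ?case by simp
next
  case (2 la)
  then show ?case by (intro exI[of _ "[]"]) (simp add: filled_by_Nil)
next
  case (3 la mu L)
  then obtain h T where T: "filled_by h T" "map shape (trace h T) = mu # L" by auto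
  have mu: "shape T = mu" using T shapes_trace[of h T] by (metis list.inject)
  have la: "is_partition la" "is_tableau T" using 3 T by (auto simp: filled_by_def)
  consider "adds_box la (shape T)" | "adds_box (shape T) la" using 3 mu by auto
  then show ?case
  proof cases
    case 1
    then obtain S x where S: "is_tableau S" "shape S = la" "row_insert x S = T" "x \<notin> entries S"
      using ex_is_tableau_row_insert la by metis
    then have "insert x (entries S) = present h"
      using T entries_row_insert by (metis filled_by_def)
    then have "filled_by (Some x # h) S" using S T by (auto simp: filled_by_def)
    then show ?thesis using S T by (intro exI[of _ "Some x # h"] exI[of _ S]) simp
  next
    case 2
    have "\<forall>y\<in>entries T. y < Suc (introduced h)"
      using T present_subset[of h] by (auto simp: filled_by_def)
    then obtain S where S: "is_tableau S" "shape S = la"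
      "entries S = insert (Suc (introduced h)) (entries T)" "delete (Suc (introduced h)) S = T"
      using ex_is_tableau_extends la 2 by (metis zero_less_Suc)
    then have "filled_by (None # h) S" using T by (auto simp: filled_by_def)
    then show ?thesis using S T by (intro exI[of _ "None # h"] exI[of _ S]) simp
  qed
qed

text \<open>Events of different kinds would make the second shape both smaller and larger than the
  first. For two ejections the inserted number is recovered by
  \<open>row_insert_inject\<close>.\<close>

lemma trace_inject:
  "filled_by h1 T1 \<Longrightarrow> filled_by h2 T2 \<Longrightarrow> trace h1 T1 = trace h2 T2 \<Longrightarrow> h1 = h2"
proof (induction h1 T1 arbitrary: h2 T2 rule: trace.induct)
  case (1 T)
  then have "length (trace h2 T2) = 1" by (metis length_trace list.size(3) One_nat_def)
  then show ?case by (simp add: length_trace)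
next
  case (2 h T)
  note D = filled_by_None[OF "2.prems"(1)]
  show ?case
  proof (cases "(h2, T2)" rule: trace.cases)
    case (1 U)
    then show ?thesis using 2 by (metis length_trace length_0_conv Pair_inject nat.inject)
  next
    case (2 h' U)
    then show ?thesis using "2.IH"[OF D(1)] "2.prems" filled_by_None(1)[of h' U] by auto
  next
    case (3 x h' U)
    then have eq: "U = T" "trace h (delete (Suc (introduced h)) T) = trace h' (row_insert x T)"
      and U: "filled_by (Some x # h') T" using "2.prems" by auto
    then have "delete (Suc (introduced h)) T = row_insert x T" by (metis trace_eq_Cons list.inject)
    then have "grow (shape T) (shape (delete (Suc (introduced h)) T))"
      using filled_by_Some[OF U] U adds_box_filled by metis
    then show ?thesis using D(2) grow_extends grow_asym by blast
  qed
next
  case (3 x h T)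
  note I = filled_by_Some[OF "3.prems"(1)]
  show ?case
  proof (cases "(h2, T2)" rule: trace.cases)
    case (1 U)
    then show ?thesis using 3 by (metis length_trace length_0_conv Pair_inject nat.inject)
  next
    case (2 h' U)
    then have eq: "U = T" "trace h' (delete (Suc (introduced h')) T) = trace h (row_insert x T)"
      and U: "filled_by (None # h') T" using "3.prems" by auto
    then have "delete (Suc (introduced h')) T = row_insert x T" by (metis trace_eq_Cons list.inject)
    then have "grow (shape T) (shape (delete (Suc (introduced h')) T))"
      using I "3.prems" adds_box_filled by metis
    then show ?thesis using filled_by_None(2)[OF U] grow_extends grow_asym by blast
  next
    case (3 y h' U)
    then have eq: "U = T" "trace h (row_insert x T) = trace h' (row_insert y T)"
      and U: "filled_by (Some y # h') T" using "3.prems" by auto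
    then have same: "row_insert x T = row_insert y T" by (metis trace_eq_Cons list.inject)
    then have "x = y"
      using row_insert_inject U by (auto simp: filled_by_def is_tableau_iff)
    then show ?thesis using "3.IH"[OF I(1) _ eq(2)] filled_by_Some(1)[OF U] 3 by auto
  qed
qed

definition histories :: "nat \<Rightarrow> history set" where
  "histories m = {h. valid h \<and> length h = m \<and> present h = {}}"

lemma filled_by_empty: "present h = {} \<Longrightarrow> filled_by h T \<longleftrightarrow> valid h \<and> T = []"
  by (cases T) (auto simp: filled_by_def is_tableau_iff)

text \<open>Injectivity rests on \<open>fillings\<close>, which reconstructs the trace from its
  shapes, and the trace in turn determines the history. Surjectivity is \<open>ex_trace\<close> with
  an empty first filling.\<close>

lemma bij_betw_trace:
  "bij_betw (\<lambda>h. map shape (trace h [])) (histories m) (oscillating_tableaux m)"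
proof (intro bij_betw_imageI)
  have filled: "filled_by h []" if "h \<in> histories m" for h
    using that by (simp add: histories_def filled_by_empty)
  show "inj_on (\<lambda>h. map shape (trace h [])) (histories m)"
  proof (rule inj_onI)
    fix h1 h2
    assume "h1 \<in> histories m" "h2 \<in> histories m"
      "map shape (trace h1 []) = map shape (trace h2 [])"
    then show "h1 = h2" using filled fillings_trace trace_inject by metis
  qed
  show "(\<lambda>h. map shape (trace h [])) ` histories m = oscillating_tableaux m"
  proof (intro equalityI subsetI)
    fix L assume "L \<in> (\<lambda>h. map shape (trace h [])) ` histories m"
    then obtain h where h: "h \<in> histories m" "L = map shape (trace h [])" by blast
    then have "hd L = []" by (metis trace_eq_Cons list.map(2) list.sel(1) shape_simps(1))
    then show "L \<in> oscillating_tableaux m"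
      using h filled osc_trace
      by (auto simp: oscillating_tableaux_iff length_trace histories_def)
  next
    fix L assume L: "L \<in> oscillating_tableaux m"
    then obtain h T where T: "filled_by h T" "map shape (trace h T) = L"
      using ex_trace oscillating_tableaux_iff by blast
    then have "shape T = []"
      using L by (metis oscillating_tableaux_iff trace_eq_Cons list.map(2) list.sel(1))
    then have "T = []" by (simp add: shape_def)
    moreover have "length h = m"
      using T L by (metis length_map length_trace nat.inject oscillating_tableaux_iff)
    ultimately have "h \<in> histories m" using T by (auto simp: histories_def filled_by_def)
    then show "L \<in> (\<lambda>h. map shape (trace h [])) ` histories m" using T \<open>T = []\<close> by blast
  qed
qed

subsection \<open>Histories and matchings\<close>

text \<open>
  Positions are counted from the right. This reflects the matching, which does not change the
  nesting relation.
\<close>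

fun position :: "history \<Rightarrow> nat \<Rightarrow> nat" where
  "position [] = (\<lambda>_. 0)"
| "position (None # h) = (position h)(Suc (introduced h) := Suc (length h))"
| "position (Some x # h) = position h"

fun edges :: "history \<Rightarrow> nat set set" where
  "edges [] = {}"
| "edges (None # h) = edges h"
| "edges (Some x # h) = insert {position h x, Suc (length h)} (edges h)"

lemma position_bounds: "k \<in> {1..introduced h} \<Longrightarrow> 1 \<le> position h k \<and> position h k \<le> length h"
  by (induction h rule: present.induct) (auto simp: le_Suc_eq Suc_le_eq)

text \<open>Numbers are introduced in increasing order, each at a position beyond all earlier ones.
  This translates comparisons of entries into comparisons of edge ends.\<close>

lemma strict_mono_on_position: "strict_mono_on {1..introduced h} (position h)"
proof (induction h rule: present.induct)
  case (2 h)
  show ?case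
  proof (rule strict_mono_onI)
    fix j k
    assume jk: "j \<in> {1..introduced (None # h)}" "k \<in> {1..introduced (None # h)}" "j < k"
    then have j: "j \<in> {1..introduced h}" by auto
    then show "position (None # h) j < position (None # h) k"
      using jk position_bounds[OF j] strict_mono_onD[OF 2 j, of k] by (auto simp: le_Suc_eq)
  qed
qed (auto simp: strict_mono_on_def)

lemma position_less_iff:
  assumes "j \<in> present h" "k \<in> present h"
  shows "position h j < position h k \<longleftrightarrow> j < k"
  using strict_mono_on_less[OF strict_mono_on_position] assms present_subset by blast

lemma inj_on_position: "inj_on (position h) (present h)"
  using strict_mono_on_imp_inj_on[OF strict_mono_on_position] present_subset inj_on_subset by blast

text \<open>The positions already read whose partner is still to come.\<close>

definition open_positions :: "history \<Rightarrow> nat set" where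
  "open_positions h = position h ` present h"

lemma open_positions_subset: "open_positions h \<subseteq> {1..length h}"
  unfolding open_positions_def using position_bounds present_subset by fastforce

lemma open_positions_simps:
  "open_positions [] = {}"
  "open_positions (None # h) = insert (Suc (length h)) (open_positions h)"
  "x \<in> present h \<Longrightarrow> open_positions (Some x # h) = open_positions h - {position h x}"
proof -
  show "open_positions (None # h) = insert (Suc (length h)) (open_positions h)"
    using Suc_introduced_notin[of h] by (auto simp: open_positions_def image_iff)
  show "open_positions (Some x # h) = open_positions h - {position h x}" if "x \<in> present h"
    using inj_on_image_set_diff[OF inj_on_position, of "present h" "{x}"] that
    by (simp add: open_positions_def)
qed (simp add: open_positions_def)

text \<open>An ejection matches an open position, which lies in no block so far, with a position
  beyond the range of all earlier blocks; the new block is therefore disjoint from the old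
  ones.\<close>

lemma partition_on_edges:
  assumes "valid h"
  shows "partition_on ({1..length h} - open_positions h) (edges h) \<and> (\<forall>e\<in>edges h. card e = 2)"
  using assms
proof (induction h rule: valid.induct)
  case 1
  then show ?case by (simp add: partition_on_empty)
next
  case (2 h)
  have "{1..length (None # h)} - open_positions (None # h) = {1..length h} - open_positions h"
    by (auto simp: open_positions_simps)
  then show ?case using 2 by simp
next
  case (3 x h)
  then have IH: "partition_on ({1..length h} - open_positions h) (edges h)"
    "\<forall>e\<in>edges h. card e = 2" and x: "x \<in> present h" by auto
  let ?p = "position h x" and ?m = "Suc (length h)"
  have p: "?p \<in> open_positions h" using x by (simp add: open_positions_def)
  then have "?p \<in> {1..length h}" using open_positions_subset by blast
  then have "?p < ?m" "1 \<le> ?p" by auto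
  have "{1..length (Some x # h)} - open_positions (Some x # h) - {?p, ?m} =
      {1..length h} - open_positions h"
    using p open_positions_subset[of h] by (auto simp: open_positions_simps x)
  moreover have "disjnt {?p, ?m} (\<Union>(edges h))"
    using p by (simp add: disjnt_iff flip: partition_onD1[OF IH(1)])
  ultimately show ?case
    using IH x \<open>?p < ?m\<close> \<open>1 \<le> ?p\<close> open_positions_subset[of h]
    by (auto simp: partition_on_insert open_positions_simps card_insert_if)
qed

lemma Union_edges: "valid h \<Longrightarrow> \<Union>(edges h) = {1..length h} - open_positions h"
  using partition_on_edges partition_onD1 by blast

text \<open>The latest position is covered exactly if the head is an ejection, and its partner then
  determines the ejected number because \<open>position\<close> is injective on present
  numbers.\<close>

lemma edges_inject:
  "valid h1 \<Longrightarrow> valid h2 \<Longrightarrow> length h1 = length h2 \<Longrightarrow> edges h1 = edges h2 \<Longrightarrow> h1 = h2"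
proof (induction h1 arbitrary: h2)
  case Nil
  then show ?case by simp
next
  case (Cons a h)
  then obtain b h' where h2: "h2 = b # h'" by (cases h2) auto
  have valid: "valid h" "valid h'" using Cons.prems h2 by (cases a; cases b; simp)+
  have len: "length h = length h'" using Cons.prems h2 by simp
  have notin: "Suc (length h) \<notin> \<Union>(edges h)" "Suc (length h) \<notin> \<Union>(edges h')"
    using Union_edges[OF valid(1)] Union_edges[OF valid(2)] len by auto
  have iff: "Suc (length h) \<in> \<Union>(edges (a # h)) \<longleftrightarrow> a \<noteq> None"
    "Suc (length h) \<in> \<Union>(edges (b # h')) \<longleftrightarrow> b \<noteq> None"
    using notin len by (cases a; cases b; simp)+
  show ?case
  proof (cases a)
    case None
    then have "b = None" using iff Cons.prems h2 by simp
    then show ?thesis using None Cons h2 by simp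
  next
    case (Some x)
    then obtain y where y: "b = Some y" using iff Cons.prems h2 by auto
    let ?e = "{position h x, Suc (length h)}" and ?e' = "{position h' y, Suc (length h)}"
    have eq: "insert ?e (edges h) = insert ?e' (edges h')"
      using Cons.prems(4) Some y h2 len by simp
    \<comment> \<open>Only the edges \<open>?e\<close> and \<open>?e'\<close> contain the latest
      position, so they can be split off from the equation.\<close>
    have "?e \<notin> edges h" "?e' \<notin> edges h'" "?e \<notin> edges h'" "?e' \<notin> edges h"
      using notin by auto
    then have "?e = ?e'" using eq by (metis insertE insertI1)
    moreover have "edges h = edges h'"
      using eq calculation \<open>?e \<notin> edges h\<close> \<open>?e' \<notin> edges h'\<close> by (metis insert_ident)
    ultimately have h: "h = h'" using Cons.IH valid len by blast
    have "position h x = position h y" using \<open>?e = ?e'\<close> h by (auto simp: doubleton_eq_iff)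
    moreover have "x \<in> present h" "y \<in> present h" using Cons.prems Some y h2 h by auto
    ultimately have "x = y" using inj_on_position by (metis inj_onD)
    then show ?thesis using h h2 Some y by simp
  qed
qed

text \<open>Generalised to partial matchings, since removing the edge at the last position uncovers
  its partner. Positions outside \<open>A\<close> become introductions that remain open.\<close>

lemma ex_edges:
  "A \<subseteq> {1..m} \<Longrightarrow> partition_on A M \<Longrightarrow> \<forall>e\<in>M. card e = 2 \<Longrightarrow>
    \<exists>h. valid h \<and> length h = m \<and> edges h = M"
proof (induction m arbitrary: A M)
  case 0
  then show ?case by (intro exI[of _ "[]"]) (simp add: partition_on_empty)
next
  case (Suc m)
  show ?case
  proof (cases "Suc m \<in> A")
    case False
    then have "A \<subseteq> {1..m}" using Suc.prems(1) by (auto simp: le_Suc_eq)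
    then obtain h where "valid h \<and> length h = m \<and> edges h = M" using Suc by blast
    then show ?thesis by (intro exI[of _ "None # h"]) simp
  next
    case True
    then obtain e where e: "e \<in> M" "Suc m \<in> e" using partition_onD1[OF Suc.prems(2)] by auto
    then obtain p where p: "e = {p, Suc m}" "p \<noteq> Suc m"
      using Suc.prems(3) by (metis card_2_iff insertE insert_commute singletonD)
    define N where "N = M - {e}"
    have M: "M = insert e N" using e N_def by auto
    have "disjnt e (\<Union>N)"
      using e partition_onD2[OF Suc.prems(2)] by (auto simp: N_def disjnt_def dest: disjointD)
    then have N: "partition_on (A - e) N" "e \<subseteq> A"
      using Suc.prems(2) M partition_on_insert by metis+
    have "A - e \<subseteq> {1..m}" using Suc.prems(1) e by (auto simp: le_Suc_eq)
    then obtain h where h: "valid h" "length h = m" "edges h = N"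
      using Suc.IH[of "A - e" N] N Suc.prems(3) N_def by auto
    have "p \<in> {1..m}" "p \<notin> \<Union>N"
      using N p Suc.prems(1) partition_onD1[OF N(1)] by (auto simp: le_Suc_eq)
    \<comment> \<open>The partner of the last position is free in \<open>N\<close>, so some present
      number was introduced there and may be ejected now.\<close>
    then have "p \<in> open_positions h" using Union_edges[OF h(1)] h by auto
    then obtain x where "x \<in> present h" "p = position h x" by (auto simp: open_positions_def)
    then show ?thesis using h M p by (intro exI[of _ "Some x # h"]) simp
  qed
qed

lemma bij_betw_edges: "bij_betw edges (histories m) (complete_matchings {1..m})"
proof (intro bij_betw_imageI)
  show "inj_on edges (histories m)"
    using edges_inject by (auto simp: histories_def intro!: inj_onI)
  have complete: "present h = {} \<longleftrightarrow> \<Union>(edges h) = {1..m}" if "valid h" "length h = m" for h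
  proof -
    have "\<Union>(edges h) = {1..m} \<longleftrightarrow> open_positions h = {}"
      using Union_edges[OF that(1)] that(2) open_positions_subset[of h] by blast
    then show ?thesis by (simp add: open_positions_def)
  qed
  show "edges ` histories m = complete_matchings {1..m}"
  proof (intro equalityI subsetI)
    fix M assume "M \<in> edges ` histories m"
    then obtain h where h: "h \<in> histories m" "M = edges h" by blast
    then show "M \<in> complete_matchings {1..m}"
      using partition_on_edges[of h]
      by (auto simp: histories_def complete_matchings_def open_positions_def)
  next
    fix M assume M: "M \<in> complete_matchings {1..m}"
    then obtain h where h: "valid h" "length h = m" "edges h = M"
      using ex_edges[of "{1..m}" m M] by (auto simp: complete_matchings_def)
    have "partition_on {1..m} M" using M by (simp add: complete_matchings_def)
    then have "present h = {}" using complete h partition_onD1 by blast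
    then show "M \<in> edges ` histories m" using h by (auto simp: histories_def)
  qed
qed

subsection \<open>Weights\<close>

text \<open>Common value of both weights: a factor \<open>wt_c\<close> for each ejection of the
  smallest number present.\<close>

fun history_weight :: "history \<Rightarrow> int poly" where
  "history_weight [] = 1"
| "history_weight (None # h) = history_weight h"
| "history_weight (Some x # h) =
    history_weight h * (if \<exists>y\<in>present h. y < x then 1 else wt_c)"

text \<open>An edge whose left end exceeds an open position will be nested once that position is matched.\<close>

definition nested_or_pending :: "history \<Rightarrow> nat set \<Rightarrow> bool" where
  "nested_or_pending h e \<longleftrightarrow> (\<exists>e'\<in>edges h. nested_by e e') \<or> (\<exists>p\<in>open_positions h. p < Min e)"

lemma finite_edges: "finite (edges h)"
  by (induction h rule: edges.induct) auto

lemma edge_bounds: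
  assumes "valid h" "e \<in> edges h"
  shows "Min e < Max e" "Max e \<le> length h"
proof -
  have "card e = 2" "e \<subseteq> {1..length h}"
    using partition_on_edges[OF assms(1)] Union_edges[OF assms(1)] assms(2) by auto
  then show "Min e < Max e" "Max e \<le> length h" by (auto simp: card_2_iff)
qed

lemma prod_edges:
  assumes "valid h"
  shows "(\<Prod>e\<in>edges h. if nested_or_pending h e then 1 else wt_c) = history_weight h"
  using assms
proof (induction h rule: valid.induct)
  case 1
  then show ?case by simp
next
  case (2 h)
  then have "valid h" by simp
  \<comment> \<open>The newly opened position lies beyond all old edges and can no longer nest any
    of them.\<close>
  then have "nested_or_pending (None # h) e \<longleftrightarrow> nested_or_pending h e" if "e \<in> edges h" for e
    using edge_bounds[OF _ that] by (auto simp: nested_or_pending_def open_positions_simps)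
  then show ?case using 2 by (simp cong: prod.cong)
next
  case (3 x h)
  then have h: "valid h" and x: "x \<in> present h" by auto
  let ?p = "position h x" and ?m = "Suc (length h)"
  let ?e = "{?p, ?m}"
  have p: "?p \<in> open_positions h" using x by (simp add: open_positions_def)
  then have "?p < ?m" using open_positions_subset[of h] by auto
  then have Min_Max: "Min ?e = ?p" "Max ?e = ?m" by auto
  \<comment> \<open>Closing \<open>?p\<close> trades a pending position for an edge that ends beyond
    \<open>e\<close>; both count for \<open>e\<close> under the same condition
    \<open>?p < Min e\<close>.\<close>
  have old: "nested_or_pending (Some x # h) e \<longleftrightarrow> nested_or_pending h e" if "e \<in> edges h" for e
  proof -
    have "nested_by e ?e \<longleftrightarrow> ?p < Min e"
      using edge_bounds[OF h that] Min_Max by (auto simp: nested_by_def)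
    then show ?thesis using p x by (auto simp: nested_or_pending_def open_positions_simps)
  qed
  \<comment> \<open>The new edge ends at the largest position read, so only positions that are still
    open can lead to an edge nesting it.\<close>
  have "\<not> nested_by ?e e'" if "e' \<in> edges (Some x # h)" for e'
    using edge_bounds(2)[OF "3.prems" that] Min_Max by (auto simp: nested_by_def)
  then have "nested_or_pending (Some x # h) ?e \<longleftrightarrow> (\<exists>q\<in>open_positions h. q < ?p)"
    using x Min_Max by (auto simp: nested_or_pending_def open_positions_simps)
  also have "\<dots> \<longleftrightarrow> (\<exists>y\<in>present h. y < x)"
    using x by (auto simp: open_positions_def position_less_iff)
  finally have new: "nested_or_pending (Some x # h) ?e \<longleftrightarrow> (\<exists>y\<in>present h. y < x)" .
  have "?m \<notin> \<Union>(edges h)" using Union_edges[OF h] by auto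
  then have "?e \<notin> edges h" by blast
  then have "(\<Prod>e\<in>edges (Some x # h). if nested_or_pending (Some x # h) e then 1 else wt_c) =
    (if \<exists>y\<in>present h. y < x then 1 else wt_c) *
    (\<Prod>e\<in>edges h. if nested_or_pending (Some x # h) e then 1 else wt_c)"
    using new by (simp add: finite_edges)
  also have "(\<Prod>e\<in>edges h. if nested_or_pending (Some x # h) e then 1 else wt_c) = history_weight h"
    using 3 old by (simp cong: prod.cong)
  finally show ?case by (simp add: mult.commute)
qed

lemma matching_weight_edges:
  assumes "h \<in> histories m"
  shows "matching_weight (edges h) = history_weight h"
  using assms prod_edges[of h]
  by (simp add: histories_def matching_weight_def nested_or_pending_def open_positions_def)

section \<open>The first column under insertion and deletion\<close>

definition first_column :: "tableau \<Rightarrow> nat set" where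
  "first_column T = hd ` set T"

definition later_columns :: "tableau \<Rightarrow> nat set" where
  "later_columns T = (\<Union>r\<in>set T. set (tl r))"

lemma first_column_only_iff: "first_column_only Ts k \<longleftrightarrow> (\<forall>T\<in>set Ts. k \<notin> later_columns T)"
proof -
  have "(\<forall>(i, j)\<in>boxes (shape T). T ! i ! j = k \<longrightarrow> j = 0) \<longleftrightarrow> k \<notin> later_columns T" for T
  proof -
    have "k \<in> set (tl r) \<longleftrightarrow> (\<exists>j<length r. r ! j = k \<and> j \<noteq> 0)" for r
      by (cases r) (auto simp: in_set_conv_nth less_Suc_eq_0_disj)
    then have "k \<in> later_columns T \<longleftrightarrow> (\<exists>r\<in>set T. \<exists>j<length r. r ! j = k \<and> j \<noteq> 0)"
      by (simp add: later_columns_def)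
    also have "\<dots> \<longleftrightarrow> (\<exists>i<length T. \<exists>j<length (T ! i). T ! i ! j = k \<and> j \<noteq> 0)"
      by (metis in_set_conv_nth)
    finally show ?thesis unfolding boxes_def shape_def by fastforce
  qed
  then show ?thesis by (simp add: first_column_only_def)
qed

lemma first_column_simps [simp]:
  "first_column [] = {}" "first_column (r # rs) = insert (hd r) (first_column rs)"
  by (simp_all add: first_column_def)

lemma later_columns_simps [simp]:
  "later_columns [] = {}" "later_columns (r # rs) = set (tl r) \<union> later_columns rs"
  by (simp_all add: later_columns_def)

lemma later_columns_subset: "later_columns T \<subseteq> entries T"
proof -
  have "set (tl r) \<subseteq> set r" for r :: "nat list" by (cases r) auto
  then show ?thesis by (fastforce simp: later_columns_def entries_def)
qed

lemma first_column_subset: "[] \<notin> set T \<Longrightarrow> first_column T \<subseteq> entries T"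
  by (induction T) auto

lemma later_columns_iff:
  "tab T \<Longrightarrow> distinct (concat T) \<Longrightarrow> k \<in> entries T \<Longrightarrow> k \<in> later_columns T \<longleftrightarrow> k \<notin> first_column T"
proof (induction T)
  case (Cons r rs)
  obtain a u where r: "r = a # u" using Cons.prems by (cases r) auto
  have disj: "set r \<inter> entries rs = {}" using Cons.prems(2) by (auto simp: entries_def)
  have sub: "later_columns rs \<subseteq> entries rs" "first_column rs \<subseteq> entries rs"
    using later_columns_subset first_column_subset tab_no_Nil Cons.prems by auto
  show ?case
  proof (cases "k \<in> set r")
    case True
    then have "k \<notin> entries rs" using disj by auto
    then show ?thesis using r Cons.prems True sub by auto
  next
    case False
    then show ?thesis using r Cons by auto
  qed
qed simp

text \<open>Insertion at the very left of a row shifts the whole first column down.\<close>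

lemma first_column_row_insert_less:
  assumes "tab T" "T \<noteq> [] \<Longrightarrow> x < hd (hd T)"
  shows "first_column (row_insert x T) = insert x (first_column T)"
  using assms
proof (induction T arbitrary: x)
  case Nil
  then show ?case by simp
next
  case (Cons r rs)
  obtain a u where r: "r = a # u" using Cons.prems by (cases r) auto
  have "a < hd (hd rs)" if "rs \<noteq> []"
  proof (cases rs)
    case (Cons s ss)
    then have "s \<noteq> []" "r ! 0 < s ! 0" using Cons.prems(1) by (auto simp: above_def)
    then show ?thesis using r Cons by (simp add: hd_conv_nth)
  qed (use that in simp)
  then have "first_column (row_insert a rs) = insert a (first_column rs)"
    using Cons by auto
  then show ?case using Cons.prems r by auto
qed

text \<open>An entry at the left of a row is either untouched or bumped by a smaller number; in the
  second case the whole first column shifts down and no entry leaves it.\<close>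

lemma first_column_row_insert_mono:
  assumes "tab T"
  shows "first_column T \<subseteq> first_column (row_insert x T)"
  using assms
proof (induction T arbitrary: x)
  case Nil
  then show ?case by simp
next
  case (Cons r rs)
  show ?case
  proof (cases "x < hd r")
    case True
    then show ?thesis using first_column_row_insert_less[OF Cons.prems, of x] by auto
  next
    case False
    show ?thesis
    proof (cases rule: bump_cases[of x r])
      case append
      then show ?thesis using Cons.prems by auto
    next
      case (replace i)
      then have "0 < i" using False Cons.prems by (cases i) (auto simp: hd_conv_nth)
      then have "hd (r[i := x]) = hd r" using Cons.prems by (simp add: hd_conv_nth)
      then show ?thesis using replace Cons by auto
    qed
  qed
qed

lemma hd_hd_le:
  assumes "tab T" "y \<in> entries T"
  shows "hd (hd T) \<le> y"
  using assms
proof (induction T)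
  case (Cons r rs)
  obtain a u where r: "r = a # u" using Cons.prems by (cases r) auto
  show ?case
  proof (cases "y \<in> set r")
    case True
    then show ?thesis using r Cons.prems by auto
  next
    case False
    then have y: "y \<in> entries rs" using Cons.prems by simp
    then obtain s ss where rs: "rs = s # ss" by (cases rs) auto
    then have "s \<noteq> []" "r ! 0 < s ! 0" using Cons.prems(1) by (auto simp: above_def)
    then have "a < hd (hd rs)" using r rs by (simp add: hd_conv_nth)
    then show ?thesis using Cons y r by auto
  qed
qed simp

text \<open>The inserted number stays in the top row and stands leftmost exactly if it is below the
  corner entry, which is the minimum of the tableau.\<close>

lemma mem_first_column_row_insert:
  assumes "tab T" "distinct (concat T)" "x \<notin> entries T"
  shows "x \<in> first_column (row_insert x T) \<longleftrightarrow> (\<forall>y\<in>entries T. x < y)"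
proof (cases T)
  case Nil
  then show ?thesis by simp
next
  case (Cons r rs)
  have r: "r \<noteq> []" using Cons assms by simp
  show ?thesis
  proof (cases "x < hd r")
    case True
    then show ?thesis
      using first_column_row_insert_less[OF assms(1), of x] hd_hd_le[OF assms(1)] Cons by fastforce
  next
    case False
    have "x \<in> later_columns (row_insert x T)"
    proof (cases rule: bump_cases[of x r])
      case append
      then show ?thesis using Cons r by simp
    next
      case (replace i)
      then obtain k where i: "i = Suc k" using False r by (cases i) (auto simp: hd_conv_nth)
      then have "x \<in> set (tl (r[i := x]))"
        using r replace(1) by (cases r) (auto simp: set_update_memI)
      then show ?thesis using replace Cons by simp
    qed
    then have "x \<notin> first_column (row_insert x T)"
      using later_columns_iff[of "row_insert x T" x] tab_row_insert[OF assms]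
        distinct_row_insert[of x T] entries_row_insert[of x T] assms by auto
    moreover have "hd r \<in> entries T" using Cons r by simp
    ultimately show ?thesis using False by blast
  qed
qed

lemma later_columns_filled:
  assumes "filled_by h T" "k \<in> present h"
  shows "k \<in> later_columns T \<longleftrightarrow> k \<notin> first_column T"
  using assms by (intro later_columns_iff) (auto simp: filled_by_def is_tableau_iff)

lemma first_column_extends:
  "extends k T S \<Longrightarrow> [] \<notin> set T \<Longrightarrow>
    first_column T \<subseteq> first_column S \<and> first_column S \<subseteq> insert k (first_column T)"
  by (induction k T S rule: extends.induct) auto

text \<open>Vacuously true, but needed for the number just introduced, which occurs in no filling
  further right.\<close>

lemma notin_trace:
  assumes "filled_by h T" "k \<notin> {1..introduced h}"
  shows "first_column_only (trace h T) k"
proof -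
  have "k \<notin> entries U" if "U \<in> set (trace h T)" for U
    using entries_trace[OF assms(1)] assms(2) that by blast
  then show ?thesis using later_columns_subset by (auto simp: first_column_only_iff)
qed

lemma first_column_only_Cons:
  "first_column_only (T # Ts) k \<longleftrightarrow> k \<notin> later_columns T \<and> first_column_only Ts k"
  by (simp add: first_column_only_iff)

text \<open>Read from right to left, entries only move up and to the right until they are ejected.\<close>

lemma first_column_only_trace:
  "filled_by h T \<Longrightarrow> k \<in> present h \<Longrightarrow> first_column_only (trace h T) k \<longleftrightarrow> k \<in> first_column T"
proof (induction h T rule: trace.induct)
  case (1 T)
  then show ?case by simp
next
  case (2 h T)
  let ?k = "Suc (introduced h)"
  let ?D = "delete ?k T"
  note D = filled_by_None[OF "2.prems"(1)]
  have "first_column ?D \<subseteq> first_column T \<and> first_column T \<subseteq> insert ?k (first_column ?D)"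
    using first_column_extends[OF D(2)] D(1) tab_no_Nil by (auto simp: filled_by_def is_tableau_iff)
  then have "k \<noteq> ?k \<Longrightarrow> k \<in> first_column ?D \<longleftrightarrow> k \<in> first_column T" by auto
  then have "k \<in> first_column T \<Longrightarrow> first_column_only (trace h ?D) k"
    using notin_trace[OF D(1), of k] "2.IH"[OF D(1)] "2.prems"(2) by (cases "k = ?k") auto
  then show ?case
    using later_columns_filled[OF "2.prems"] by (auto simp: first_column_only_Cons)
next
  case (3 x h T)
  note I = filled_by_Some[OF "3.prems"(1)]
  have "first_column T \<subseteq> first_column (row_insert x T)"
    using "3.prems" first_column_row_insert_mono by (auto simp: filled_by_def is_tableau_iff)
  then show ?case
    using later_columns_filled[OF "3.prems"] "3.IH"[OF I(1)] "3.prems"(2)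
    by (auto simp: first_column_only_Cons)
qed

text \<open>Only ejected numbers are counted, since a present number may still move to a later
  column. An ejected number is absent from all fillings further left, so its factor no longer
  changes.\<close>

lemma prod_ejected:
  "filled_by h T \<Longrightarrow>
    (\<Prod>k\<in>{1..introduced h} - present h. if first_column_only (trace h T) k then wt_c else 1) =
    history_weight h"
proof (induction h T rule: trace.induct)
  case (1 T)
  then show ?case by simp
next
  case (2 h T)
  let ?D = "delete (Suc (introduced h)) T"
  have "k \<notin> later_columns T" if "k \<in> {1..introduced h} - present h" for k
    using later_columns_subset[of T] that "2.prems" by (auto simp: filled_by_def)
  moreover have "{1..introduced (None # h)} - present (None # h) = {1..introduced h} - present h"
    by auto
  ultimately have "(\<Prod>k\<in>{1..introduced (None # h)} - present (None # h).
      if first_column_only (trace (None # h) T) k then wt_c else 1) =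
    (\<Prod>k\<in>{1..introduced h} - present h. if first_column_only (trace h ?D) k then wt_c else 1)"
    by (intro prod.cong) (auto simp: first_column_only_Cons)
  then show ?case using "2.IH" filled_by_None[OF "2.prems"] by simp
next
  case (3 x h T)
  let ?I = "row_insert x T"
  let ?E = "{1..introduced h} - present h"
  note I = filled_by_Some[OF "3.prems"]
  have x: "x \<in> present h" and T: "entries T = present h - {x}" "tab T" "distinct (concat T)"
    using "3.prems" by (auto simp: filled_by_def is_tableau_iff)
  have later: "k \<notin> later_columns T" if "k \<in> insert x ?E" for k
    using later_columns_subset[of T] that T by auto
  have "{1..introduced (Some x # h)} - present (Some x # h) = insert x ?E"
    using x present_subset[of h] by auto
  then have "(\<Prod>k\<in>{1..introduced (Some x # h)} - present (Some x # h).
      if first_column_only (trace (Some x # h) T) k then wt_c else 1) =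
    (\<Prod>k\<in>insert x ?E. if first_column_only (trace h ?I) k then wt_c else 1)"
    using later by (intro prod.cong) (auto simp: first_column_only_Cons)
  also have "\<dots> = (if first_column_only (trace h ?I) x then wt_c else 1) * history_weight h"
    using "3.IH"[OF I(1)] x by simp
  \<comment> \<open>The filling just to the right of the ejection decides for all later ones, by
    \<open>first_column_only_trace\<close>.\<close>
  also have "first_column_only (trace h ?I) x \<longleftrightarrow> (\<forall>y\<in>entries T. x < y)"
    using first_column_only_trace[OF I(1) x] mem_first_column_row_insert[OF T(2,3) I(3)] by simp
  also have "\<dots> \<longleftrightarrow> \<not> (\<exists>y\<in>present h. y < x)"
    using T(1) by (auto simp: not_less le_less)
  finally show ?case by (simp add: mult.commute)
qed

lemma tableau_weight_trace:
  assumes "h \<in> histories (2 * n)"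
  shows "tableau_weight n (map shape (trace h [])) = history_weight h"
proof -
  have h: "valid h" "length h = 2 * n" "present h = {}" using assms by (auto simp: histories_def)
  then have "introduced h = n" using card_present[of h] by simp
  moreover have "filled_by h []" using h by (simp add: filled_by_empty)
  ultimately show ?thesis
    using prod_ejected[of h "[]"] h by (simp add: tableau_weight_def fillings_trace)
qed

theorem mainTheorem6:
  fixes n :: nat
  shows "\<exists>f. bij_betw f (oscillating_tableaux (2 * n)) (complete_matchings {1..2 * n}) \<and>
    (\<forall>L\<in>oscillating_tableaux (2 * n). matching_weight (f L) = tableau_weight n L)"
proof -
  let ?H = "histories (2 * n)" and ?g = "\<lambda>h. map shape (trace h [])"
  let ?f = "edges \<circ> inv_into ?H ?g"
  note g = bij_betw_trace[of "2 * n"]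
  have "bij_betw ?f (oscillating_tableaux (2 * n)) (complete_matchings {1..2 * n})"
    using bij_betw_inv_into[OF g] bij_betw_edges by (rule bij_betw_trans)
  moreover have "matching_weight (?f L) = tableau_weight n L"
    if "L \<in> oscillating_tableaux (2 * n)" for L
  proof -
    have "inv_into ?H ?g L \<in> ?H" "?g (inv_into ?H ?g L) = L"
      using g that f_inv_into_f[of L ?g ?H] inv_into_into[of L ?g ?H] by (auto simp: bij_betw_def)
    then show ?thesis using matching_weight_edges tableau_weight_trace by (metis comp_apply)
  qed
  ultimately show ?thesis by blast
qed

end
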